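(* Let $g$ be the Kerr-(anti-)de Sitter metric with real parameters $a,\Lambda$ and $m>0$ (see context). Then the differential curvature invariant $$Q_1=\frac{1}{3\sqrt3}\,\frac{(I_1^2-I_2^2)(I_5-I_6)+4I_1I_2I_7}{(I_1^2+I_2^2)^{9/4}}$$ of $g$ equals $$Q_1=-\frac{\left(\Lambda a^4\cos^4\theta-\Lambda a^4\cos^2\theta-\Lambda a^2r^2-\Lambda r^4+3a^2\cos^2\theta-6mr+3r^2\right)\left(a^2\cos^2\theta-r^2\right)}{3\left(r^2+a^2\cos^2\theta\right)^{3/2}m}.$$
   Context: Kerr-(anti-)de Sitter metric: in coordinates $(t,r,\theta,\phi)$, signature $(-,+,+,+)$, $$ds^2=-\frac{\Delta_r}{\Xi^2\rho^2}(dt-a\sin^2\theta\,d\phi)^2+\frac{\rho^2}{\Delta_r}dr^2+\frac{\rho^2}{\Delta_\theta}d\theta^2+\frac{\Delta_\theta\sin^2\theta}{\Xi^2\rho^2}\big(a\,dt-(r^2+a^2)d\phi\big)^2,$$ $\Delta_\theta=1+\frac{a^2\Lambda}{3}\cos^2\theta$, $\Xi=1+\frac{a^2\Lambda}{3}$, $\Delta_r=(1-\frac{\Lambda}{3}r^2)(r^2+a^2)-2mr$, $\rho^2=r^2+a^2\cos^2\theta$, on the domain where the metric is regular ($\rho^2\neq0$, $\Delta_r\ne0$, $\Delta_\theta>0$, $\Xi\neq0$, $\sin\theta\ne0$). With $C_{\alpha\beta\gamma\delta}$ the Weyl tensor and $C^*_{\alpha\beta\gamma\delta}=\frac12E_{\alpha\beta\kappa\lambda}C^{\kappa\lambda}{}_{\gamma\delta}$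 its dual ($E$ the Levi-Civita pseudotensor; $Q_1$ does not depend on orientation): $I_1=C_{\alpha\beta\gamma\delta}C^{\alpha\beta\gamma\delta}$, $I_2=C^*_{\alpha\beta\gamma\delta}C^{\alpha\beta\gamma\delta}$, $k_\mu=-\nabla_\mu I_1$, $l_\mu=-\nabla_\mu I_2$, $I_5=k_\mu k^\mu$, $I_6=l_\mu l^\mu$, $I_7=k_\mu l^\mu$. *)

theory Defs
  imports "HOL-Analysis.Analysis"
begin

section \<open>Tensor calculus in a coordinate chart\<close>

text \<open>
  A metric in a chart is a matrix-valued function \<open>g\<close> of the coordinates; tensors are given
  by their components at the point \<open>x\<close>. Apart from
  the inverse metric, all indices are down unless a remark says otherwise.
\<close>

definition partial :: "'n::finite \<Rightarrow> (real^'n \<Rightarrow> real) \<Rightarrow> real^'n \<Rightarrow> real" where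
  "partial i f x = deriv (\<lambda>s. f (x + s *\<^sub>R axis i 1)) 0"

definition inv_metric :: "(real^'n \<Rightarrow> real^'n^'n) \<Rightarrow> real^'n \<Rightarrow> real^'n^'n" where
  "inv_metric g x = matrix_inv (g x)"

definition christoffel ::
    "(real^'n::finite \<Rightarrow> real^'n^'n) \<Rightarrow> 'n \<Rightarrow> 'n \<Rightarrow> 'n \<Rightarrow> real^'n \<Rightarrow> real" where
  \<comment> \<open>\<open>christoffel g a b c\<close> is \<open>\<Gamma>\<^sup>a\<^sub>b\<^sub>c\<close>\<close>
  "christoffel g a b c x =
     (1/2) * (\<Sum>d\<in>UNIV. inv_metric g x $ a $ d *
       (partial b (\<lambda>y. g y $ d $ c) x + partial c (\<lambda>y. g y $ d $ b) x
        - partial d (\<lambda>y. g y $ b $ c) x))"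

definition riemann_up ::
    "(real^'n::finite \<Rightarrow> real^'n^'n) \<Rightarrow> 'n \<Rightarrow> 'n \<Rightarrow> 'n \<Rightarrow> 'n \<Rightarrow> real^'n \<Rightarrow> real" where
  \<comment> \<open>\<open>riemann_up g a b c d\<close> is \<open>R\<^sup>a\<^sub>b\<^sub>c\<^sub>d\<close>\<close>
  "riemann_up g a b c d x =
     partial c (christoffel g a b d) x - partial d (christoffel g a b c) x
     + (\<Sum>e\<in>UNIV. christoffel g a c e x * christoffel g e b d x
                 - christoffel g a d e x * christoffel g e b c x)"

definition riemann ::
    "(real^'n::finite \<Rightarrow> real^'n^'n) \<Rightarrow> 'n \<Rightarrow> 'n \<Rightarrow> 'n \<Rightarrow> 'n \<Rightarrow> real^'n \<Rightarrow> real" where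
  "riemann g a b c d x = (\<Sum>e\<in>UNIV. g x $ a $ e * riemann_up g e b c d x)"

definition ricci :: "(real^'n::finite \<Rightarrow> real^'n^'n) \<Rightarrow> 'n \<Rightarrow> 'n \<Rightarrow> real^'n \<Rightarrow> real" where
  "ricci g b d x = (\<Sum>a\<in>UNIV. riemann_up g a b a d x)"

definition scalar_curvature :: "(real^'n::finite \<Rightarrow> real^'n^'n) \<Rightarrow> real^'n \<Rightarrow> real" where
  "scalar_curvature g x = (\<Sum>b\<in>UNIV. \<Sum>d\<in>UNIV. inv_metric g x $ b $ d * ricci g b d x)"

definition weyl ::
    "(real^'n::finite \<Rightarrow> real^'n^'n) \<Rightarrow> 'n \<Rightarrow> 'n \<Rightarrow> 'n \<Rightarrow> 'n \<Rightarrow> real^'n \<Rightarrow> real" where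
  "weyl g a b c d x =
     riemann g a b c d x
     - (g x $ a $ c * ricci g b d x - g x $ a $ d * ricci g b c x
        - g x $ b $ c * ricci g a d x + g x $ b $ d * ricci g a c x) / (real CARD('n) - 2)
     + scalar_curvature g x * (g x $ a $ c * g x $ b $ d - g x $ a $ d * g x $ b $ c)
        / ((real CARD('n) - 1) * (real CARD('n) - 2))"

definition levi_civita_symbol :: "4 \<Rightarrow> 4 \<Rightarrow> 4 \<Rightarrow> 4 \<Rightarrow> real" where
  "levi_civita_symbol a b c d =
     (let p = (\<lambda>i. if i = 1 then a else if i = 2 then b else if i = 3 then c else d)
      in if distinct [a, b, c, d] then of_int (sign p) else 0)"

definition levi_civita ::
    "(real^4 \<Rightarrow> real^4^4) \<Rightarrow> 4 \<Rightarrow> 4 \<Rightarrow> 4 \<Rightarrow> 4 \<Rightarrow> real^4 \<Rightarrow> real" where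
  "levi_civita g a b c d x = sqrt \<bar>det (g x)\<bar> * levi_civita_symbol a b c d"

definition weyl_dual ::
    "(real^4 \<Rightarrow> real^4^4) \<Rightarrow> 4 \<Rightarrow> 4 \<Rightarrow> 4 \<Rightarrow> 4 \<Rightarrow> real^4 \<Rightarrow> real" where
  "weyl_dual g a b c d x =
     (1/2) * (\<Sum>k\<in>UNIV. \<Sum>l\<in>UNIV. levi_civita g a b k l x *
       (\<Sum>p\<in>UNIV. \<Sum>q\<in>UNIV. inv_metric g x $ k $ p * inv_metric g x $ l $ q
          * weyl g p q c d x))"

definition contract4 ::
    "(real^'n::finite \<Rightarrow> real^'n^'n) \<Rightarrow> ('n \<Rightarrow> 'n \<Rightarrow> 'n \<Rightarrow> 'n \<Rightarrow> real^'n \<Rightarrow> real) \<Rightarrow>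
     ('n \<Rightarrow> 'n \<Rightarrow> 'n \<Rightarrow> 'n \<Rightarrow> real^'n \<Rightarrow> real) \<Rightarrow> real^'n \<Rightarrow> real" where
  \<comment> \<open>\<open>S\<^sub>a\<^sub>b\<^sub>c\<^sub>d T\<^sup>a\<^sup>b\<^sup>c\<^sup>d\<close>\<close>
  "contract4 g S T x =
     (\<Sum>a\<in>UNIV. \<Sum>b\<in>UNIV. \<Sum>c\<in>UNIV. \<Sum>d\<in>UNIV. S a b c d x *
       (\<Sum>p\<in>UNIV. \<Sum>q\<in>UNIV. \<Sum>u\<in>UNIV. \<Sum>v\<in>UNIV.
          inv_metric g x $ a $ p * inv_metric g x $ b $ q
          * inv_metric g x $ c $ u * inv_metric g x $ d $ v * T p q u v x))"

definition contract1 ::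
    "(real^'n::finite \<Rightarrow> real^'n^'n) \<Rightarrow> ('n \<Rightarrow> real^'n \<Rightarrow> real) \<Rightarrow>
     ('n \<Rightarrow> real^'n \<Rightarrow> real) \<Rightarrow> real^'n \<Rightarrow> real" where
  "contract1 g u v x = (\<Sum>a\<in>UNIV. \<Sum>b\<in>UNIV. inv_metric g x $ a $ b * u a x * v b x)"


section \<open>Curvature invariants\<close>

definition I1 :: "(real^4 \<Rightarrow> real^4^4) \<Rightarrow> real^4 \<Rightarrow> real" where
  "I1 g x = contract4 g (weyl g) (weyl g) x"

definition I2 :: "(real^4 \<Rightarrow> real^4^4) \<Rightarrow> real^4 \<Rightarrow> real" where
  "I2 g x = contract4 g (weyl_dual g) (weyl g) x"

definition k_covector :: "(real^4 \<Rightarrow> real^4^4) \<Rightarrow> 4 \<Rightarrow> real^4 \<Rightarrow> real" where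
  "k_covector g i x = - partial i (I1 g) x"

definition l_covector :: "(real^4 \<Rightarrow> real^4^4) \<Rightarrow> 4 \<Rightarrow> real^4 \<Rightarrow> real" where
  "l_covector g i x = - partial i (I2 g) x"

definition I5 :: "(real^4 \<Rightarrow> real^4^4) \<Rightarrow> real^4 \<Rightarrow> real" where
  "I5 g x = contract1 g (k_covector g) (k_covector g) x"

definition I6 :: "(real^4 \<Rightarrow> real^4^4) \<Rightarrow> real^4 \<Rightarrow> real" where
  "I6 g x = contract1 g (l_covector g) (l_covector g) x"

definition I7 :: "(real^4 \<Rightarrow> real^4^4) \<Rightarrow> real^4 \<Rightarrow> real" where
  "I7 g x = contract1 g (k_covector g) (l_covector g) x"

definition Q1 :: "(real^4 \<Rightarrow> real^4^4) \<Rightarrow> real^4 \<Rightarrow> real" where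
  "Q1 g x = 1 / (3 * sqrt 3) *
     ((((I1 g x)\<^sup>2 - (I2 g x)\<^sup>2) * (I5 g x - I6 g x) + 4 * I1 g x * I2 g x * I7 g x)
      / ((I1 g x)\<^sup>2 + (I2 g x)\<^sup>2) powr (9/4))"


section \<open>The Kerr-(anti-)de Sitter metric\<close>

definition Delta_theta :: "real \<Rightarrow> real \<Rightarrow> real \<Rightarrow> real" where
  "Delta_theta a \<Lambda> \<theta> = 1 + a\<^sup>2 * \<Lambda> / 3 * (cos \<theta>)\<^sup>2"

definition Xi :: "real \<Rightarrow> real \<Rightarrow> real" where
  "Xi a \<Lambda> = 1 + a\<^sup>2 * \<Lambda> / 3"

definition Delta_r :: "real \<Rightarrow> real \<Rightarrow> real \<Rightarrow> real \<Rightarrow> real" where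
  "Delta_r a \<Lambda> m r = (1 - \<Lambda> / 3 * r\<^sup>2) * (r\<^sup>2 + a\<^sup>2) - 2 * m * r"

definition rho2 :: "real \<Rightarrow> real \<Rightarrow> real \<Rightarrow> real" where
  "rho2 a r \<theta> = r\<^sup>2 + a\<^sup>2 * (cos \<theta>)\<^sup>2"

text \<open>
  The coordinates \<open>(t, r, \<theta>, \<phi>)\<close> have the indices 1, 2, 3, 4. The line element is a combination
  of squares of the 1-forms \<open>dt - a sin\<^sup>2\<theta> d\<phi>\<close>, \<open>dr\<close>, \<open>d\<theta>\<close> and \<open>a dt - (r\<^sup>2 + a\<^sup>2) d\<phi>\<close>, which are
  the vectors \<open>\<omega>\<^sub>t\<close>, \<open>axis 2 1\<close>, \<open>axis 3 1\<close> and \<open>\<omega>\<^sub>\<phi>\<close> of their components.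
\<close>

definition kerr_dS_metric :: "real \<Rightarrow> real \<Rightarrow> real \<Rightarrow> real^4 \<Rightarrow> real^4^4" where
  "kerr_dS_metric a \<Lambda> m x =
     (let r = x $ 2; \<theta> = x $ 3;
          \<omega>\<^sub>t = (vector [1, 0, 0, - a * (sin \<theta>)\<^sup>2] :: real^4);
          \<omega>\<^sub>\<phi> = (vector [a, 0, 0, - (r\<^sup>2 + a\<^sup>2)] :: real^4)
      in \<chi> i j.
           - (Delta_r a \<Lambda> m r / ((Xi a \<Lambda>)\<^sup>2 * rho2 a r \<theta>)) * (\<omega>\<^sub>t $ i * \<omega>\<^sub>t $ j)
           + rho2 a r \<theta> / Delta_r a \<Lambda> m r * (axis 2 1 $ i * axis 2 1 $ j)
           + rho2 a r \<theta> / Delta_theta a \<Lambda> \<theta> * (axis 3 1 $ i * axis 3 1 $ j)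
           + Delta_theta a \<Lambda> \<theta> * (sin \<theta>)\<^sup>2 / ((Xi a \<Lambda>)\<^sup>2 * rho2 a r \<theta>) * (\<omega>\<^sub>\<phi> $ i * \<omega>\<^sub>\<phi> $ j))"

end

theory Submission
  imports Defs
begin

text \<open>
  The metric is of Carter's form \<open>- R/P \<omega>\<^sub>1\<^sup>2 + P/R dr\<^sup>2 + P/M du\<^sup>2 + M/P \<omega>\<^sub>4\<^sup>2\<close> with \<open>u = cos \<theta>\<close>,
  \<open>\<omega>\<^sub>1 = (dt - a sin\<^sup>2 \<theta> d\<phi>) / \<Xi>\<close>, \<open>\<omega>\<^sub>4 = (a dt - (r\<^sup>2 + a\<^sup>2) d\<phi>) / \<Xi>\<close>,
  \<open>P = r\<^sup>2 + a\<^sup>2 u\<^sup>2\<close>, \<open>R = \<Delta>\<^sub>r\<close> and \<open>M = \<Delta>\<^sub>\<theta> sin\<^sup>2 \<theta>\<close>. Cartan's structure equations for the orthogonal coframe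
  \<open>\<omega>\<^sub>1, dr/R, du/M, \<omega>\<^sub>4\<close> only involve polynomials and powers of \<open>1/P\<close>. They give \<open>Ric = \<Lambda> g\<close> and a
  Weyl tensor of type D, determined by the single complex number \<open>A + \<i> B = m / \<zeta>\<^sup>3\<close>, \<open>\<zeta> = r - \<i> a u\<close>.
  Duality multiplies \<open>A + \<i> B\<close> by \<open>\<plusminus>\<i>\<close>, hence \<open>I\<^sub>1 \<minusplus> \<i> I\<^sub>2 = 48 m\<^sup>2 / \<zeta>\<^sup>6\<close>, whose gradient is
  \<open>-6 (I\<^sub>1 \<minusplus> \<i> I\<^sub>2) d\<zeta> / \<zeta>\<close>. Since \<open>g(d\<zeta>, d\<zeta>) = (R - a\<^sup>2 M) / P\<close>, the numerator of \<open>Q\<^sub>1\<close> is \<open>36 |I\<^sub>1 \<minusplus> \<i> I\<^sub>2|\<^sup>4 Re(1/\<zeta>\<^sup>2) (R - a\<^sup>2 M) / P\<close>.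
\<close>

section \<open>Partial derivatives\<close>

text \<open>The coframe is orthogonal rather than orthonormal because normalising would need roots
  of \<open>R\<close> and \<open>M\<close>, and the sign of \<open>R\<close> is not fixed: where it
  is negative, \<open>dr\<close> is timelike. With the norms kept in \<open>h\<close>, one set of
  rational formulas serves both signs. The price is a connection form with diagonal part
  \<open>dh / (2 h)\<close> that is skew only after weighting by \<open>h\<close>. Since
  \<open>christoffel\<close> and \<open>riemann_up\<close> are given in coordinates, the frame
  calculus has to be proved equivalent to them. A second obstacle is orientation. The symbol in
  \<open>levi_civita\<close> refers to the chart, but \<open>du = - sin \<theta> d\<theta>\<close>,
  so the coframe changes orientation with the sign of \<open>sin \<theta>\<close>. \<open>I2\<close>
  carries this sign, which is locally constant and cancels in \<open>Q1\<close>. The constants of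
  \<open>Q1\<close> fit the modulus \<open>48 m^2 / P^3\<close> of the complex invariant: the
  numerator has degree 4 in it, the denominator degree 9/2. What remains is its square root
  \<open>4 sqrt 3 m / P^(3/2)\<close>, and \<open>4 sqrt 3\<close> times \<open>3 sqrt 3\<close> is
  the 36 of the numerator.\<close>

definition has_partial :: "'n::finite \<Rightarrow> (real^'n \<Rightarrow> real) \<Rightarrow> real \<Rightarrow> real^'n \<Rightarrow> bool" where
  "has_partial i f D x \<longleftrightarrow> ((\<lambda>s. f (x + s *\<^sub>R axis i 1)) has_real_derivative D) (at 0)"

text \<open>\<open>deriv\<close> is total, so an equation about \<open>partial\<close> does not
  assert differentiability. Calculations therefore carry \<open>has_partial\<close> and pass to
  \<open>partial\<close> only at the end.\<close>

lemma partial_eqI: "has_partial i f D x \<Longrightarrow> partial i f x = D"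
  unfolding has_partial_def partial_def by (rule DERIV_imp_deriv)

lemma has_partial_add:
  "has_partial i f D x \<Longrightarrow> has_partial i g D' x \<Longrightarrow> has_partial i (\<lambda>x. f x + g x) (D + D') x"
  unfolding has_partial_def by (rule DERIV_add)

lemma has_partial_mult:
  "has_partial i f D x \<Longrightarrow> has_partial i g D' x \<Longrightarrow>
    has_partial i (\<lambda>x. f x * g x) (D * g x + f x * D') x"
  unfolding has_partial_def using DERIV_mult[of "\<lambda>s. f (x + s *\<^sub>R axis i 1)" D 0 UNIV "\<lambda>s. g (x + s *\<^sub>R axis i 1)" D']
  by (simp add: mult.commute)

lemma has_partial_sum:
  "(\<And>k. k \<in> K \<Longrightarrow> has_partial i (f k) (D k) x) \<Longrightarrow>
    has_partial i (\<lambda>x. \<Sum>k\<in>K. f k x) (\<Sum>k\<in>K. D k) x"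
  unfolding has_partial_def by (rule DERIV_sum)

text \<open>A coordinate derivative sees only a short segment through \<open>x\<close>, and openness
  keeps it in \<open>U\<close>. This permits differentiating identities that hold on
  \<open>U\<close> alone.\<close>

lemma eventually_line:
  fixes x :: "real^'n"
  assumes "open U" "x \<in> U"
  shows "\<forall>\<^sub>F s in nhds 0. x + s *\<^sub>R axis i 1 \<in> U"
proof -
  have "((\<lambda>s::real. x + s *\<^sub>R axis i 1) \<longlongrightarrow> x + 0 *\<^sub>R axis i 1) (nhds 0)"
    by (intro tendsto_intros filterlim_ident)
  then show ?thesis
    using assms by (simp add: tendsto_def)
qed

lemma has_partial_cong:
  assumes "open U" "x \<in> U" "\<And>y. y \<in> U \<Longrightarrow> f y = g y"
  shows "has_partial i f D x \<longleftrightarrow> has_partial i g D x"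
  unfolding has_partial_def
  by (rule DERIV_cong_ev) (use eventually_line[OF assms(1,2), of i] assms(3) in \<open>auto elim: eventually_mono\<close>)

lemma partial_cong:
  assumes "open U" "x \<in> U" "\<And>y. y \<in> U \<Longrightarrow> f y = g y"
  shows "partial i f x = partial i g x"
  unfolding partial_def
  by (rule deriv_cong_ev) (use eventually_line[OF assms(1,2), of i] assms(3) in \<open>auto elim: eventually_mono\<close>)

section \<open>Orthogonal coframes\<close>

definition diag :: "('n::finite \<Rightarrow> real) \<Rightarrow> real^'n^'n" where
  "diag d = (\<chi> i j. if i = j then d i else 0)"

lemma diag_mult: "(diag d ** A) $ i $ j = d i * A $ i $ j"
  by (simp add: diag_def matrix_matrix_mult_def mult_delta_left)

lemma mult_diag: "(A ** diag d) $ i $ j = A $ i $ j * d j"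
  by (simp add: diag_def matrix_matrix_mult_def mult_delta_right)

lemma diag_diag: "diag c ** diag d = diag (\<lambda>i. c i * d i)"
  by (simp add: vec_eq_iff diag_mult) (simp add: diag_def)

lemma diag_1: "diag (\<lambda>i. 1) = mat 1"
  by (simp add: diag_def mat_def)

lemma diag_transpose: "transpose (diag d) = diag d"
  by (auto simp: diag_def transpose_def vec_eq_iff)

lemma mult_diag_mult: "(A ** diag d ** B) $ a $ b = (\<Sum>i\<in>UNIV. A $ a $ i * d i * B $ i $ b)"
  by (subst matrix_matrix_mult_def) (simp add: mult_diag)

lemma matrix_add_rdistrib: "(A + B) ** C = A ** C + B ** (C :: 'a::semiring_1^'n^'m)"
  by (simp add: vec_eq_iff matrix_matrix_mult_def distrib_right sum.distrib)

lemma matrix_diff_ldistrib: "A ** (B - C) = A ** B - A ** (C :: 'a::ring_1^'n^'m)"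
  by (simp add: vec_eq_iff matrix_matrix_mult_def right_diff_distrib sum_subtractf)

lemma matrix_diff_rdistrib: "(A - B) ** C = A ** C - B ** (C :: 'a::ring_1^'n^'m)"
  by (simp add: vec_eq_iff matrix_matrix_mult_def left_diff_distrib sum_subtractf)

text \<open>
  All three indices of \<open>om i j k\<close> refer to the coframe \<open>W\<close>: it is the component along \<open>W\<^sup>k\<close> of the
  connection form \<open>\<omega>\<^sup>i\<^sub>j\<close>, where \<open>dW\<^sup>i = - \<omega>\<^sup>i\<^sub>j \<and> W\<^sup>j\<close>. Likewise the last index of \<open>d_om\<close> is a derivative along
  the dual frame, whereas the last indices of \<open>dW\<close> and \<open>ddW\<close> are coordinate derivatives.
\<close>

definition conn :: "(real^'n::finite \<Rightarrow> real^'n^'n) \<Rightarrow> (real^'n \<Rightarrow> 'n \<Rightarrow> 'n \<Rightarrow> 'n \<Rightarrow> real) \<Rightarrow>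
    real^'n \<Rightarrow> 'n \<Rightarrow> 'n \<Rightarrow> 'n \<Rightarrow> real" where
  "conn W om x i j c = (\<Sum>k\<in>UNIV. om x i j k * W x $ k $ c)"

text \<open>Components of \<open>d\<omega> + \<omega> \<and> \<omega>\<close> along the coframe. The
  last sum stems from the exterior derivatives of the coframe itself, already expressed by the
  connection through the first structure equation.\<close>

definition frame_curv :: "('n::finite \<Rightarrow> 'n \<Rightarrow> 'n \<Rightarrow> real) \<Rightarrow> ('n \<Rightarrow> 'n \<Rightarrow> 'n \<Rightarrow> 'n \<Rightarrow> real) \<Rightarrow>
    'n \<Rightarrow> 'n \<Rightarrow> 'n \<Rightarrow> 'n \<Rightarrow> real" where
  "frame_curv om d_om i j k l = d_om i j l k - d_om i j k l
    + (\<Sum>n\<in>UNIV. om i n k * om n j l - om i n l * om n j k)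
    + (\<Sum>n\<in>UNIV. om i j n * (om n k l - om n l k))"

lemma frame_curv_skew: "frame_curv om d_om i j l k = - frame_curv om d_om i j k l"
  unfolding frame_curv_def by (simp add: algebra_simps sum_subtractf)

text \<open>\<open>W\<close> has the 1-forms as rows, \<open>E\<close> the dual vectors as columns.
  \<open>h_partial\<close> and \<open>om_skew\<close> are the diagonal and off-diagonal halves of
  metric compatibility; \<open>torsion_free\<close> is the first structure equation. For
  \<open>E\<close> the existence of derivatives suffices, as their values do not enter the
  curvature.\<close>

locale orthogonal_coframe =
  fixes g :: "real^'n::finite \<Rightarrow> real^'n^'n" and U :: "(real^'n) set"
    and W E :: "real^'n \<Rightarrow> real^'n^'n"
    and h :: "real^'n \<Rightarrow> 'n \<Rightarrow> real"
    and dW :: "real^'n \<Rightarrow> 'n \<Rightarrow> 'n \<Rightarrow> 'n \<Rightarrow> real"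
    and ddW :: "real^'n \<Rightarrow> 'n \<Rightarrow> 'n \<Rightarrow> 'n \<Rightarrow> 'n \<Rightarrow> real"
    and om :: "real^'n \<Rightarrow> 'n \<Rightarrow> 'n \<Rightarrow> 'n \<Rightarrow> real"
    and d_om :: "real^'n \<Rightarrow> 'n \<Rightarrow> 'n \<Rightarrow> 'n \<Rightarrow> 'n \<Rightarrow> real"
  assumes open_U: "open U"
    and g_eq: "\<And>x. x \<in> U \<Longrightarrow> g x = transpose (W x) ** diag (h x) ** W x"
    and W_E: "\<And>x. x \<in> U \<Longrightarrow> W x ** E x = mat 1"
    and h_nz: "\<And>x i. x \<in> U \<Longrightarrow> h x i \<noteq> 0"
    and W_partial: "\<And>x i b c. x \<in> U \<Longrightarrow> has_partial c (\<lambda>y. W y $ i $ b) (dW x i b c) x"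
    and dW_partial: "\<And>x i b c d. x \<in> U \<Longrightarrow> has_partial d (\<lambda>y. dW y i b c) (ddW x i b c d) x"
    and ddW_sym: "\<And>x i b c d. x \<in> U \<Longrightarrow> ddW x i b c d = ddW x i b d c"
    and E_partial: "\<And>x a i c. x \<in> U \<Longrightarrow> \<exists>D. has_partial c (\<lambda>y. E y $ a $ i) D x"
    and h_partial: "\<And>x i c. x \<in> U \<Longrightarrow> has_partial c (\<lambda>y. h y i) (2 * h x i * conn W om x i i c) x"
    and om_partial: "\<And>x i j k c. x \<in> U \<Longrightarrow>
      has_partial c (\<lambda>y. om y i j k) (\<Sum>l\<in>UNIV. d_om x i j k l * W x $ l $ c) x"
    and om_skew: "\<And>x i j k. x \<in> U \<Longrightarrow> i \<noteq> j \<Longrightarrow> h x i * om x i j k = - h x j * om x j i k"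
    and torsion_free: "\<And>x i b c. x \<in> U \<Longrightarrow>
      dW x i b c + (\<Sum>j\<in>UNIV. conn W om x i j c * W x $ j $ b)
      = dW x i c b + (\<Sum>j\<in>UNIV. conn W om x i j b * W x $ j $ c)"
begin

section \<open>Christoffel symbols from the connection form\<close>

definition mixed_christoffel :: "real^'n \<Rightarrow> 'n \<Rightarrow> 'n \<Rightarrow> 'n \<Rightarrow> real" where
  "mixed_christoffel x i b c = dW x i b c + (\<Sum>j\<in>UNIV. conn W om x i j c * W x $ j $ b)"

text \<open>Solves the condition that the full covariant derivative of the coframe vanishes:
  \<open>mixed_christoffel\<close> is the Christoffel symbol with its upper index moved to the
  frame, and \<open>E\<close> moves it back.\<close>

definition frame_christoffel :: "real^'n \<Rightarrow> 'n \<Rightarrow> 'n \<Rightarrow> 'n \<Rightarrow> real" where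
  "frame_christoffel x a b c = (\<Sum>i\<in>UNIV. E x $ a $ i * mixed_christoffel x i b c)"

lemma E_W: "x \<in> U \<Longrightarrow> E x ** W x = mat 1"
  using W_E matrix_left_right_inverse by blast

lemma E_W_sum: "x \<in> U \<Longrightarrow> (\<Sum>i\<in>UNIV. E x $ a $ i * W x $ i $ b) = (if a = b then 1 else 0)"
  using arg_cong[OF E_W, of x "\<lambda>M. M $ a $ b"] by (simp add: matrix_matrix_mult_def mat_def)

lemma W_E_sum: "x \<in> U \<Longrightarrow> (\<Sum>a\<in>UNIV. W x $ i $ a * E x $ a $ j) = (if i = j then 1 else 0)"
  using arg_cong[OF W_E, of x "\<lambda>M. M $ i $ j"] by (simp add: matrix_matrix_mult_def mat_def)

lemma mixed_christoffel_sym: "x \<in> U \<Longrightarrow> mixed_christoffel x i b c = mixed_christoffel x i c b"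
  unfolding mixed_christoffel_def by (rule torsion_free)

lemma g_comp: "x \<in> U \<Longrightarrow> g x $ a $ b = (\<Sum>i\<in>UNIV. h x i * (W x $ i $ a * W x $ i $ b))"
  by (simp add: g_eq mult_diag_mult transpose_def mult_ac)

lemma inv_metric_eq:
  assumes "x \<in> U"
  shows "inv_metric g x = E x ** diag (\<lambda>i. 1 / h x i) ** transpose (E x)"
proof -
  let ?H = "diag (h x)"
  let ?K = "diag (\<lambda>i. 1 / h x i)"
  have HK: "?H ** ?K = mat 1"
    using h_nz[OF assms]
    by (simp add: diag_diag diag_1)
  have WtEt: "transpose (W x) ** transpose (E x) = mat 1"
    by (metis E_W[OF assms] matrix_transpose_mul transpose_mat)
  have "g x ** (E x ** ?K ** transpose (E x)) =
      transpose (W x) ** (?H ** ((W x ** E x) ** ?K)) ** transpose (E x)"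
    by (simp add: g_eq[OF assms] matrix_mul_assoc)
  also have "\<dots> = mat 1"
    by (simp add: W_E[OF assms] HK WtEt)
  finally have right: "g x ** (E x ** ?K ** transpose (E x)) = mat 1" .
  then have left: "(E x ** ?K ** transpose (E x)) ** g x = mat 1"
    using matrix_left_right_inverse by blast
  let ?M = "E x ** ?K ** transpose (E x)"
  \<comment> \<open>\<open>matrix_inv\<close> is a choice among two-sided inverses, so
    \<open>?M\<close> first serves as a witness that one exists and is then identified with the
    chosen one.\<close>
  have "g x ** matrix_inv (g x) = mat 1"
    unfolding matrix_inv_def using someI[of "\<lambda>A'. g x ** A' = mat 1 \<and> A' ** g x = mat 1" ?M] left right
    by blast
  then have "?M ** (g x ** matrix_inv (g x)) = ?M"
    by simp
  then show ?thesis
    by (simp add: matrix_mul_assoc left inv_metric_def)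
qed

lemma inv_metric_comp:
  "x \<in> U \<Longrightarrow> inv_metric g x $ a $ b = (\<Sum>i\<in>UNIV. E x $ a $ i / h x i * E x $ b $ i)"
  by (simp add: inv_metric_eq mult_diag_mult transpose_def)

definition christoffel_low :: "real^'n \<Rightarrow> 'n \<Rightarrow> 'n \<Rightarrow> 'n \<Rightarrow> real" where
  "christoffel_low x a b c = (\<Sum>i\<in>UNIV. h x i * W x $ i $ a * mixed_christoffel x i b c)"

lemma conn_skew: "x \<in> U \<Longrightarrow> i \<noteq> j \<Longrightarrow> h x i * conn W om x i j c = - h x j * conn W om x j i c"
  unfolding conn_def sum_distrib_left mult.assoc[symmetric]
  using om_skew[of x i j] by simp

lemma metric_compatible:
  assumes x: "x \<in> U"
  shows "partial c (\<lambda>y. g y $ a $ b) x = christoffel_low x a b c + christoffel_low x b a c"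
proof -
  let ?W = "W x" and ?h = "h x" and ?C = "conn W om x"
  have "has_partial c (\<lambda>y. \<Sum>i\<in>UNIV. h y i * (W y $ i $ a * W y $ i $ b))
     (\<Sum>i\<in>UNIV. (2 * h x i * ?C i i c) * (?W $ i $ a * ?W $ i $ b) +
        h x i * (dW x i a c * ?W $ i $ b + ?W $ i $ a * dW x i b c)) x"
    by (intro has_partial_sum has_partial_mult h_partial W_partial x)
  then have "has_partial c (\<lambda>y. g y $ a $ b)
     (\<Sum>i\<in>UNIV. (2 * h x i * ?C i i c) * (?W $ i $ a * ?W $ i $ b) +
        h x i * (dW x i a c * ?W $ i $ b + ?W $ i $ a * dW x i b c)) x"
    by (subst has_partial_cong[OF open_U x, where g="\<lambda>y. \<Sum>i\<in>UNIV. h y i * (W y $ i $ a * W y $ i $ b)"])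
      (simp_all add: g_comp)
  then have "partial c (\<lambda>y. g y $ a $ b) x =
     (\<Sum>i\<in>UNIV. (2 * h x i * ?C i i c) * (?W $ i $ a * ?W $ i $ b)) +
      (\<Sum>i\<in>UNIV. h x i * (dW x i a c * ?W $ i $ b + ?W $ i $ a * dW x i b c))"
    by (simp add: partial_eqI sum.distrib)
  \<comment> \<open>The diagonal sum coming from \<open>dh\<close> is spread over all pairs
    \<open>i\<close>, \<open>j\<close>, since off the diagonal the summand vanishes by weighted
    skewness. The double sum then splits into the connection terms of the two lowered
    symbols.\<close>
  moreover have "(\<Sum>i\<in>UNIV. (2 * h x i * ?C i i c) * (?W $ i $ a * ?W $ i $ b)) =
     (\<Sum>i\<in>UNIV. \<Sum>j\<in>UNIV. (h x i * ?C i j c + h x j * ?C j i c) * (?W $ i $ a * ?W $ j $ b))"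
  proof (rule sum.cong[OF refl])
    fix i
    have "(h x i * ?C i j c + h x j * ?C j i c) * (?W $ i $ a * ?W $ j $ b) =
      (if i = j then (2 * h x i * ?C i i c) * (?W $ i $ a * ?W $ i $ b) else 0)" for j
      using conn_skew[OF x, of i j c] by simp
    then show "(2 * h x i * ?C i i c) * (?W $ i $ a * ?W $ i $ b) =
       (\<Sum>j\<in>UNIV. (h x i * ?C i j c + h x j * ?C j i c) * (?W $ i $ a * ?W $ j $ b))"
      by simp
  qed
  moreover have "(\<Sum>i\<in>UNIV. \<Sum>j\<in>UNIV. (h x i * ?C i j c + h x j * ?C j i c) * (?W $ i $ a * ?W $ j $ b))
     = (\<Sum>i\<in>UNIV. h x i * ?W $ i $ a * (\<Sum>j\<in>UNIV. ?C i j c * ?W $ j $ b))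
      + (\<Sum>i\<in>UNIV. h x i * ?W $ i $ b * (\<Sum>j\<in>UNIV. ?C i j c * ?W $ j $ a))"
  proof -
    have "(\<Sum>i\<in>UNIV. \<Sum>j\<in>UNIV. h x j * ?C j i c * (?W $ i $ a * ?W $ j $ b)) =
      (\<Sum>i\<in>UNIV. \<Sum>j\<in>UNIV. h x i * ?C i j c * (?W $ j $ a * ?W $ i $ b))"
      by (rule sum.swap)
    then show ?thesis
      by (simp add: distrib_left distrib_right sum.distrib sum_distrib_left mult_ac)
  qed
  ultimately show ?thesis
    unfolding christoffel_low_def mixed_christoffel_def by (simp add: algebra_simps sum.distrib)
qed

text \<open>Uniqueness of the Levi-Civita connection: for a symmetric, metric connection the
  alternating sum of derivatives of \<open>g\<close> reduces to twice one lowered symbol.\<close>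

lemma christoffel_eq:
  assumes x: "x \<in> U"
  shows "christoffel g a b c x = frame_christoffel x a b c"
proof -
  have christoffel_low_sym: "christoffel_low x d b c = christoffel_low x d c b" for d b c
    unfolding christoffel_low_def using mixed_christoffel_sym[OF x] by simp
  have "christoffel g a b c x = (\<Sum>d\<in>UNIV. inv_metric g x $ a $ d * christoffel_low x d b c)"
    unfolding christoffel_def metric_compatible[OF x] sum_distrib_left
    by (rule sum.cong[OF refl])
       (simp add: christoffel_low_sym[of _ c b] christoffel_low_sym[of c] christoffel_low_sym[of b] algebra_simps)
  also have "\<dots> = (\<Sum>d\<in>UNIV. \<Sum>i\<in>UNIV. \<Sum>j\<in>UNIV. E x $ a $ i / h x i * (W x $ j $ d * E x $ d $ i) * (h x j * mixed_christoffel x j b c))"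
    by (simp add: inv_metric_comp[OF x] christoffel_low_def sum_product mult_ac)
  also have "\<dots> = (\<Sum>i\<in>UNIV. \<Sum>j\<in>UNIV. \<Sum>d\<in>UNIV. E x $ a $ i / h x i * (W x $ j $ d * E x $ d $ i) * (h x j * mixed_christoffel x j b c))"
    by (subst sum.swap, rule sum.cong[OF refl], rule sum.swap)
  also have "\<dots> = (\<Sum>i\<in>UNIV. \<Sum>j\<in>UNIV. if j = i then E x $ a $ i / h x i * (h x j * mixed_christoffel x j b c) else 0)"
    by (intro sum.cong refl)
      (simp add: W_E_sum[OF x] del: times_divide_eq_left flip: sum_distrib_left sum_distrib_right)
  also have "\<dots> = frame_christoffel x a b c"
    unfolding frame_christoffel_def using h_nz[OF x] by simp
  finally show ?thesis .
qed

lemma frame_christoffel_sym: "x \<in> U \<Longrightarrow> frame_christoffel x a b c = frame_christoffel x a c b"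
  unfolding frame_christoffel_def using mixed_christoffel_sym by simp

section \<open>Curvature and the second structure equation\<close>

definition dconn :: "real^'n \<Rightarrow> 'n \<Rightarrow> 'n \<Rightarrow> 'n \<Rightarrow> 'n \<Rightarrow> real" where
  "dconn x i j c d = (\<Sum>k\<in>UNIV. (\<Sum>l\<in>UNIV. d_om x i j k l * W x $ l $ d) * W x $ k $ c
     + om x i j k * dW x k c d)"

definition d_mixed_christoffel :: "real^'n \<Rightarrow> 'n \<Rightarrow> 'n \<Rightarrow> 'n \<Rightarrow> 'n \<Rightarrow> real" where
  "d_mixed_christoffel x i b c d = ddW x i b c d +
    (\<Sum>j\<in>UNIV. dconn x i j c d * W x $ j $ b + conn W om x i j c * dW x j b d)"

lemma conn_partial: "x \<in> U \<Longrightarrow> has_partial d (\<lambda>y. conn W om y i j c) (dconn x i j c d) x"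
  unfolding conn_def dconn_def
  by (intro has_partial_sum has_partial_mult om_partial W_partial)

lemma mixed_christoffel_partial: "x \<in> U \<Longrightarrow> has_partial d (\<lambda>y. mixed_christoffel y i b c) (d_mixed_christoffel x i b c d) x"
  unfolding mixed_christoffel_def d_mixed_christoffel_def
  by (intro has_partial_add has_partial_sum has_partial_mult dW_partial conn_partial W_partial)

text \<open>Only existence is extracted from \<open>E_partial\<close>. The derivative itself is
  later determined by differentiating the identity \<open>W_frame_christoffel\<close>, in which
  \<open>E\<close> no longer occurs.\<close>

lemma frame_christoffel_partial:
  assumes x: "x \<in> U"
  shows "has_partial d (\<lambda>y. frame_christoffel y a b c) (partial d (\<lambda>y. frame_christoffel y a b c) x) x"
proof -
  obtain dE where "\<And>i. has_partial d (\<lambda>y. E y $ a $ i) (dE i) x"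
    using E_partial[OF x, of d a] by metis
  then have "has_partial d (\<lambda>y. frame_christoffel y a b c)
     (\<Sum>i\<in>UNIV. dE i * mixed_christoffel x i b c + E x $ a $ i * d_mixed_christoffel x i b c d) x"
    unfolding frame_christoffel_def by (intro has_partial_sum has_partial_mult mixed_christoffel_partial x)
  from this partial_eqI[OF this] show ?thesis
    by simp
qed

lemma W_frame_christoffel:
  assumes x: "x \<in> U"
  shows "(\<Sum>a\<in>UNIV. W x $ i $ a * frame_christoffel x a b c) = mixed_christoffel x i b c"
proof -
  have "(\<Sum>a\<in>UNIV. W x $ i $ a * frame_christoffel x a b c) =
     (\<Sum>a\<in>UNIV. \<Sum>j\<in>UNIV. W x $ i $ a * E x $ a $ j * mixed_christoffel x j b c)"
    by (simp add: frame_christoffel_def sum_distrib_left mult_ac)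
  also have "\<dots> = (\<Sum>j\<in>UNIV. (\<Sum>a\<in>UNIV. W x $ i $ a * E x $ a $ j) * mixed_christoffel x j b c)"
    by (subst sum.swap) (simp add: sum_distrib_right)
  also have "\<dots> = mixed_christoffel x i b c"
    by (simp add: W_E_sum[OF x] mult_delta_left)
  finally show ?thesis .
qed

lemma W_d_frame_christoffel:
  assumes x: "x \<in> U"
  shows "(\<Sum>a\<in>UNIV. dW x i a d * frame_christoffel x a b c + W x $ i $ a * partial d (\<lambda>y. frame_christoffel y a b c) x) = d_mixed_christoffel x i b c d"
proof -
  have "has_partial d (\<lambda>y. \<Sum>a\<in>UNIV. W y $ i $ a * frame_christoffel y a b c)
      (\<Sum>a\<in>UNIV. dW x i a d * frame_christoffel x a b c + W x $ i $ a * partial d (\<lambda>y. frame_christoffel y a b c) x) x"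
    by (intro has_partial_sum has_partial_mult W_partial frame_christoffel_partial x)
  then have "has_partial d (\<lambda>y. mixed_christoffel y i b c)
      (\<Sum>a\<in>UNIV. dW x i a d * frame_christoffel x a b c + W x $ i $ a * partial d (\<lambda>y. frame_christoffel y a b c) x) x"
    by (subst has_partial_cong[OF open_U x, where g="\<lambda>y. \<Sum>a\<in>UNIV. W y $ i $ a * frame_christoffel y a b c"])
      (simp_all add: W_frame_christoffel)
  from partial_eqI[OF this] partial_eqI[OF mixed_christoffel_partial[OF x, of d i b c]] show ?thesis
    by (rule subst)
qed

definition coord_curv :: "real^'n \<Rightarrow> 'n \<Rightarrow> 'n \<Rightarrow> 'n \<Rightarrow> 'n \<Rightarrow> real" where
  "coord_curv x i j c d = dconn x i j d c - dconn x i j c d +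
    (\<Sum>n\<in>UNIV. conn W om x i n c * conn W om x n j d - conn W om x i n d * conn W om x n j c)"

text \<open>In matrix form \<open>?W ** \<Gamma> = V + \<Omega> ** ?W\<close> is a gauge
  transformation. Differentiating it, antisymmetrising, which removes the second derivatives of
  \<open>W\<close>, and eliminating \<open>V\<close> carries the curvature of one connection into
  that of the other.\<close>

lemma W_riemann_up:
  assumes x: "x \<in> U"
  shows "(\<Sum>a\<in>UNIV. W x $ i $ a * riemann_up g a b c d x)
    = (\<Sum>j\<in>UNIV. coord_curv x i j c d * W x $ j $ b)"
proof -
  let ?W = "W x"
  define \<Gamma> where "\<Gamma> c = (\<chi> a b. frame_christoffel x a b c)" for c
  define V where "V c = (\<chi> i b. dW x i b c)" for c
  define \<Omega> where "\<Omega> c = (\<chi> i j. conn W om x i j c)" for c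
  define d\<Gamma> where "d\<Gamma> c d = (\<chi> a b. partial d (\<lambda>y. frame_christoffel y a b c) x)" for c d
  define d\<Omega> where "d\<Omega> c d = (\<chi> i j. dconn x i j c d)" for c d
  define X where "X c d = (\<chi> i b. ddW x i b c d)" for c d
  note defs = \<Gamma>_def V_def \<Omega>_def d\<Gamma>_def d\<Omega>_def X_def
  have A: "?W ** \<Gamma> c = V c + \<Omega> c ** ?W" for c
    using W_frame_christoffel[OF x] by (simp add: vec_eq_iff matrix_matrix_mult_def mixed_christoffel_def defs)
  have B: "V d ** \<Gamma> c + ?W ** d\<Gamma> c d = X c d + (d\<Omega> c d ** ?W + \<Omega> c ** V d)" for c d
    using W_d_frame_christoffel[OF x] by (simp add: vec_eq_iff matrix_matrix_mult_def sum.distrib d_mixed_christoffel_def defs)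
  have X: "X c d = X d c" for c d
    using ddW_sym[OF x] by (simp add: X_def vec_eq_iff)
  have VA: "V c = ?W ** \<Gamma> c - \<Omega> c ** ?W" for c
    using A[of c] by simp
  have "?W ** (d\<Gamma> d c - d\<Gamma> c d + (\<Gamma> c ** \<Gamma> d - \<Gamma> d ** \<Gamma> c))
    = (d\<Omega> d c - d\<Omega> c d + (\<Omega> c ** \<Omega> d - \<Omega> d ** \<Omega> c)) ** ?W"
  proof -
    have B': "?W ** d\<Gamma> c d = X c d + d\<Omega> c d ** ?W + \<Omega> c ** V d - V d ** \<Gamma> c" for c d
      using B[of d c] by (simp add: algebra_simps)
    show ?thesis
      by (simp add: matrix_add_ldistrib matrix_add_rdistrib matrix_diff_ldistrib matrix_diff_rdistrib
          B' VA X[of d c] matrix_mul_assoc)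
  qed
  then have "(?W ** (d\<Gamma> d c - d\<Gamma> c d + (\<Gamma> c ** \<Gamma> d - \<Gamma> d ** \<Gamma> c))) $ i $ b
    = ((d\<Omega> d c - d\<Omega> c d + (\<Omega> c ** \<Omega> d - \<Omega> d ** \<Omega> c)) ** ?W) $ i $ b"
    by simp
  moreover have "partial d (christoffel g a b c) x = partial d (\<lambda>y. frame_christoffel y a b c) x" for a b c d
    by (rule partial_cong[OF open_U x]) (rule christoffel_eq)
  ultimately show ?thesis
    unfolding riemann_up_def coord_curv_def christoffel_eq[OF x]
    by (simp add: matrix_matrix_mult_def defs sum_subtractf frame_christoffel_sym[OF x])
qed

text \<open>The antisymmetrised derivatives of \<open>W\<close> in \<open>dconn\<close> are replaced
  by connection coefficients through \<open>torsion_free\<close>; afterwards \<open>W\<close> enters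
  only algebraically.\<close>

lemma coord_curv_eq:
  assumes x: "x \<in> U"
  shows "coord_curv x i j c d = (\<Sum>k\<in>UNIV. \<Sum>l\<in>UNIV. frame_curv (om x) (d_om x) i j k l * (W x $ k $ c * W x $ l $ d))"
proof -
  let ?W = "W x" and ?o = "om x" and ?C = "conn W om x"
  have 1: "(\<Sum>n\<in>UNIV. ?C i n c * ?C n j d - ?C i n d * ?C n j c) =
    (\<Sum>k\<in>UNIV. \<Sum>l\<in>UNIV. (\<Sum>n\<in>UNIV. ?o i n k * ?o n j l - ?o i n l * ?o n j k) * (?W $ k $ c * ?W $ l $ d))"
  proof -
    have "(\<Sum>n\<in>UNIV. ?C i n c * ?C n j d) =
      (\<Sum>n\<in>UNIV. \<Sum>k\<in>UNIV. \<Sum>l\<in>UNIV. ?o i n k * ?o n j l * (?W $ k $ c * ?W $ l $ d))"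
      unfolding conn_def sum_product by (simp add: mult_ac)
    also have "\<dots> = (\<Sum>k\<in>UNIV. \<Sum>l\<in>UNIV. \<Sum>n\<in>UNIV. ?o i n k * ?o n j l * (?W $ k $ c * ?W $ l $ d))"
      by (subst sum.swap, rule sum.cong[OF refl], rule sum.swap)
    finally have a: "(\<Sum>n\<in>UNIV. ?C i n c * ?C n j d) = \<dots>" .
    have "(\<Sum>n\<in>UNIV. ?C i n d * ?C n j c) =
      (\<Sum>n\<in>UNIV. \<Sum>l\<in>UNIV. \<Sum>k\<in>UNIV. ?o i n l * ?o n j k * (?W $ k $ c * ?W $ l $ d))"
      unfolding conn_def sum_product by (simp add: mult_ac)
    also have "\<dots> = (\<Sum>n\<in>UNIV. \<Sum>k\<in>UNIV. \<Sum>l\<in>UNIV. ?o i n l * ?o n j k * (?W $ k $ c * ?W $ l $ d))"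
      by (rule sum.cong[OF refl], rule sum.swap)
    also have "\<dots> = (\<Sum>k\<in>UNIV. \<Sum>l\<in>UNIV. \<Sum>n\<in>UNIV. ?o i n l * ?o n j k * (?W $ k $ c * ?W $ l $ d))"
      by (subst sum.swap, rule sum.cong[OF refl], rule sum.swap)
    finally show ?thesis
      by (simp add: a sum_subtractf sum_distrib_right left_diff_distrib)
  qed
  have 2: "dW x n d c - dW x n c d = (\<Sum>k\<in>UNIV. \<Sum>l\<in>UNIV. (?o n k l - ?o n l k) * (?W $ k $ c * ?W $ l $ d))" for n
  proof -
    have "(\<Sum>j\<in>UNIV. ?C n j d * ?W $ j $ c) = (\<Sum>k\<in>UNIV. \<Sum>l\<in>UNIV. ?o n k l * (?W $ k $ c * ?W $ l $ d))"
      by (simp add: conn_def sum_distrib_left sum_distrib_right mult_ac)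
    moreover have "(\<Sum>j\<in>UNIV. ?C n j c * ?W $ j $ d) = (\<Sum>l\<in>UNIV. \<Sum>k\<in>UNIV. ?o n l k * (?W $ k $ c * ?W $ l $ d))"
      by (simp add: conn_def sum_distrib_left sum_distrib_right mult_ac)
    moreover have "\<dots> = (\<Sum>k\<in>UNIV. \<Sum>l\<in>UNIV. ?o n l k * (?W $ k $ c * ?W $ l $ d))"
      by (rule sum.swap)
    ultimately show ?thesis
      using torsion_free[OF x, of n d c] by (simp add: left_diff_distrib sum_subtractf)
  qed
  have 3: "(\<Sum>n\<in>UNIV. ?o i j n * (dW x n d c - dW x n c d)) =
     (\<Sum>k\<in>UNIV. \<Sum>l\<in>UNIV. (\<Sum>n\<in>UNIV. ?o i j n * (?o n k l - ?o n l k)) * (?W $ k $ c * ?W $ l $ d))"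
  proof -
    have "(\<Sum>n\<in>UNIV. ?o i j n * (dW x n d c - dW x n c d)) =
       (\<Sum>n\<in>UNIV. \<Sum>k\<in>UNIV. \<Sum>l\<in>UNIV. ?o i j n * (?o n k l - ?o n l k) * (?W $ k $ c * ?W $ l $ d))"
      by (simp add: 2 sum_distrib_left mult.assoc)
    also have "\<dots> = (\<Sum>k\<in>UNIV. \<Sum>l\<in>UNIV. \<Sum>n\<in>UNIV. ?o i j n * (?o n k l - ?o n l k) * (?W $ k $ c * ?W $ l $ d))"
      by (subst sum.swap, rule sum.cong[OF refl], rule sum.swap)
    finally show ?thesis
      by (simp add: sum_distrib_right)
  qed
  have 4: "(\<Sum>k\<in>UNIV. (\<Sum>l\<in>UNIV. d_om x i j k l * ?W $ l $ c) * ?W $ k $ d) =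
     (\<Sum>k\<in>UNIV. \<Sum>l\<in>UNIV. d_om x i j l k * (?W $ k $ c * ?W $ l $ d))"
    unfolding sum_distrib_right by (subst sum.swap) (simp add: mult_ac)
  have 5: "(\<Sum>k\<in>UNIV. (\<Sum>l\<in>UNIV. d_om x i j k l * ?W $ l $ d) * ?W $ k $ c) =
     (\<Sum>k\<in>UNIV. \<Sum>l\<in>UNIV. d_om x i j k l * (?W $ k $ c * ?W $ l $ d))"
    unfolding sum_distrib_right by (simp add: mult_ac)
  have "coord_curv x i j c d =
      (\<Sum>k\<in>UNIV. (\<Sum>l\<in>UNIV. d_om x i j k l * ?W $ l $ c) * ?W $ k $ d)
      - (\<Sum>k\<in>UNIV. (\<Sum>l\<in>UNIV. d_om x i j k l * ?W $ l $ d) * ?W $ k $ c)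
      + (\<Sum>n\<in>UNIV. ?o i j n * (dW x n d c - dW x n c d))
      + (\<Sum>n\<in>UNIV. ?C i n c * ?C n j d - ?C i n d * ?C n j c)"
    unfolding coord_curv_def dconn_def by (simp add: sum.distrib sum_subtractf algebra_simps)
  then show ?thesis
    unfolding 1 3 4 5 frame_curv_def
    by (simp add: distrib_right left_diff_distrib sum.distrib sum_subtractf)
qed

end

section \<open>Tensors as matrices over index pairs\<close>

text \<open>
  A tensor with four indices is a bilinear form on pairs of indices, on which a change of frame acts by
  a Kronecker square. Contractions become traces, so their invariance reduces to matrix algebra.
\<close>

definition kron :: "real^'n::finite^'m::finite \<Rightarrow> real^('n \<times> 'n)^('m \<times> 'm)" where
  "kron A = (\<chi> p q. A $ fst p $ fst q * A $ snd p $ snd q)"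

definition bimat :: "('n::finite \<Rightarrow> 'n \<Rightarrow> 'n \<Rightarrow> 'n \<Rightarrow> real) \<Rightarrow> real^('n \<times> 'n)^('n \<times> 'n)" where
  "bimat T = (\<chi> p q. T (fst p) (snd p) (fst q) (snd q))"

lemma sum_UNIV_prod:
  "(\<Sum>p\<in>(UNIV :: ('a::finite \<times> 'b::finite) set). f p) = (\<Sum>i\<in>UNIV. \<Sum>j\<in>UNIV. f (i, j))"
  by (simp add: sum.cartesian_product flip: UNIV_Times_UNIV)

lemma kron_mult: "kron (A ** B) = kron A ** kron B"
  unfolding kron_def matrix_matrix_mult_def vec_eq_iff
  by (simp add: sum_UNIV_prod sum_product) (simp add: mult_ac)

lemma kron_transpose: "kron (transpose A) = transpose (kron A)"
  by (simp add: kron_def transpose_def)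

lemma kron_mat_1: "kron (mat 1) = mat 1"
  by (auto simp: kron_def mat_def vec_eq_iff)

lemma kron_diag: "kron (diag d) = diag (\<lambda>p. d (fst p) * d (snd p))"
  by (auto simp: kron_def diag_def vec_eq_iff)

lemma kron_pullback:
  "(transpose (kron A) ** bimat T ** kron A) $ (a, b) $ (c, d) =
    (\<Sum>i\<in>UNIV. \<Sum>j\<in>UNIV. \<Sum>k\<in>UNIV. \<Sum>l\<in>UNIV.
      T i j k l * (A $ i $ a * A $ j $ b * (A $ k $ c * A $ l $ d)))"
proof -
  have "(transpose (kron A) ** bimat T ** kron A) $ (a, b) $ (c, d) =
     (\<Sum>k\<in>UNIV. \<Sum>l\<in>UNIV. \<Sum>i\<in>UNIV. \<Sum>j\<in>UNIV.
      T i j k l * (A $ i $ a * A $ j $ b * (A $ k $ c * A $ l $ d)))"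
    by (simp add: matrix_matrix_mult_def transpose_def kron_def bimat_def sum_UNIV_prod sum_distrib_left sum_distrib_right mult_ac)
  also have "\<dots> = (\<Sum>q\<in>UNIV. \<Sum>p\<in>UNIV.
      T (fst p) (snd p) (fst q) (snd q) * (A $ fst p $ a * A $ snd p $ b * (A $ fst q $ c * A $ snd q $ d)))"
    by (simp add: sum_UNIV_prod)
  also have "\<dots> = (\<Sum>p\<in>UNIV. \<Sum>q\<in>UNIV.
      T (fst p) (snd p) (fst q) (snd q) * (A $ fst p $ a * A $ snd p $ b * (A $ fst q $ c * A $ snd q $ d)))"
    by (rule sum.swap)
  finally show ?thesis
    by (simp add: sum_UNIV_prod)
qed

lemma contract4_trace:
  "contract4 g S T x = trace (transpose (bimat (\<lambda>a b c d. S a b c d x)) **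
     (kron (inv_metric g x) ** bimat (\<lambda>a b c d. T a b c d x) ** transpose (kron (inv_metric g x))))"
proof -
  let ?gi = "inv_metric g x"
  have 1: "(kron ?gi ** bimat (\<lambda>a b c d. T a b c d x) ** transpose (kron ?gi)) $ (a, b) $ (c, d) =
     (\<Sum>p\<in>UNIV. \<Sum>q\<in>UNIV. \<Sum>u\<in>UNIV. \<Sum>v\<in>UNIV.
       ?gi $ a $ p * ?gi $ b $ q * ?gi $ c $ u * ?gi $ d $ v * T p q u v x)" for a b c d
    using kron_pullback[of "transpose ?gi" "\<lambda>a b c d. T a b c d x" a b c d]
    by (simp add: kron_transpose) (simp add: transpose_def mult_ac)
  have "trace (transpose (bimat (\<lambda>a b c d. S a b c d x)) ** M) =
    (\<Sum>a\<in>UNIV. \<Sum>b\<in>UNIV. \<Sum>c\<in>UNIV. \<Sum>d\<in>UNIV. S a b c d x * M $ (a, b) $ (c, d))" for M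
  proof -
    have "trace (transpose (bimat (\<lambda>a b c d. S a b c d x)) ** M) =
       (\<Sum>q\<in>UNIV. \<Sum>p\<in>UNIV. S (fst p) (snd p) (fst q) (snd q) x * M $ p $ q)"
      by (simp add: trace_def matrix_matrix_mult_def transpose_def bimat_def)
    also have "\<dots> = (\<Sum>p\<in>UNIV. \<Sum>q\<in>UNIV. S (fst p) (snd p) (fst q) (snd q) x * M $ p $ q)"
      by (rule sum.swap)
    finally show ?thesis
      by (simp add: sum_UNIV_prod)
  qed
  then show ?thesis
    by (simp add: 1 contract4_def)
qed

section \<open>Frame components of the curvature tensors and their contractions\<close>

context orthogonal_coframe
begin

lemma riemann_eq:
  assumes x: "x \<in> U"
  shows "riemann g a b c d x = (\<Sum>i\<in>UNIV. \<Sum>j\<in>UNIV. \<Sum>k\<in>UNIV. \<Sum>l\<in>UNIV.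
    h x i * frame_curv (om x) (d_om x) i j k l * (W x $ i $ a * W x $ j $ b * (W x $ k $ c * W x $ l $ d)))"
proof -
  have "riemann g a b c d x = (\<Sum>e\<in>UNIV. \<Sum>i\<in>UNIV. h x i * W x $ i $ a * (W x $ i $ e * riemann_up g e b c d x))"
    by (simp add: riemann_def g_comp[OF x] sum_distrib_left sum_distrib_right mult_ac)
  also have "\<dots> = (\<Sum>i\<in>UNIV. h x i * W x $ i $ a * (\<Sum>e\<in>UNIV. W x $ i $ e * riemann_up g e b c d x))"
    by (subst sum.swap) (simp add: sum_distrib_left)
  finally show ?thesis
    by (simp add: W_riemann_up[OF x] coord_curv_eq[OF x] sum_distrib_left sum_distrib_right mult_ac)
qed

lemma riemann_up_eq:
  assumes x: "x \<in> U"
  shows "riemann_up g a b c d x = (\<Sum>i\<in>UNIV. \<Sum>j\<in>UNIV. E x $ a $ i * (coord_curv x i j c d * W x $ j $ b))"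
proof -
  have "(\<Sum>i\<in>UNIV. \<Sum>j\<in>UNIV. E x $ a $ i * (coord_curv x i j c d * W x $ j $ b)) =
    (\<Sum>i\<in>UNIV. E x $ a $ i * (\<Sum>e\<in>UNIV. W x $ i $ e * riemann_up g e b c d x))"
    by (simp add: W_riemann_up[OF x] sum_distrib_left)
  also have "\<dots> = (\<Sum>i\<in>UNIV. \<Sum>e\<in>UNIV. (E x $ a $ i * W x $ i $ e) * riemann_up g e b c d x)"
    by (simp add: sum_distrib_left mult_ac)
  also have "\<dots> = (\<Sum>e\<in>UNIV. (\<Sum>i\<in>UNIV. E x $ a $ i * W x $ i $ e) * riemann_up g e b c d x)"
    by (subst sum.swap) (simp add: sum_distrib_right)
  finally show ?thesis
    by (simp add: E_W_sum[OF x] mult_delta_left)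
qed

lemma ricci_eq:
  assumes x: "x \<in> U"
  shows "ricci g b d x = (\<Sum>j\<in>UNIV. \<Sum>l\<in>UNIV. (\<Sum>i\<in>UNIV. frame_curv (om x) (d_om x) i j i l) * (W x $ j $ b * W x $ l $ d))"
proof -
  let ?F = "frame_curv (om x) (d_om x)" and ?W = "W x" and ?E = "E x"
  have contr: "(\<Sum>a\<in>UNIV. ?E $ a $ i * coord_curv x i j a d) = (\<Sum>l\<in>UNIV. ?F i j i l * ?W $ l $ d)" for i j
  proof -
    have "(\<Sum>a\<in>UNIV. ?E $ a $ i * coord_curv x i j a d) =
      (\<Sum>a\<in>UNIV. \<Sum>k\<in>UNIV. (?W $ k $ a * ?E $ a $ i) * (\<Sum>l\<in>UNIV. ?F i j k l * ?W $ l $ d))"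
      by (simp add: coord_curv_eq[OF x] sum_distrib_left mult_ac)
    also have "\<dots> = (\<Sum>k\<in>UNIV. (\<Sum>a\<in>UNIV. ?W $ k $ a * ?E $ a $ i) * (\<Sum>l\<in>UNIV. ?F i j k l * ?W $ l $ d))"
      unfolding sum_distrib_right[of "\<lambda>a. _ a * _ a"] by (rule sum.swap)
    finally show ?thesis
      by (simp add: W_E_sum[OF x] mult_delta_left)
  qed
  have "ricci g b d x = (\<Sum>a\<in>UNIV. \<Sum>i\<in>UNIV. \<Sum>j\<in>UNIV. ?E $ a $ i * (coord_curv x i j a d * ?W $ j $ b))"
    by (simp add: ricci_def riemann_up_eq[OF x])
  also have "\<dots> = (\<Sum>i\<in>UNIV. \<Sum>j\<in>UNIV. \<Sum>a\<in>UNIV. ?E $ a $ i * (coord_curv x i j a d * ?W $ j $ b))"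
    by (subst sum.swap, rule sum.cong[OF refl], rule sum.swap)
  also have "\<dots> = (\<Sum>i\<in>UNIV. \<Sum>j\<in>UNIV. (\<Sum>a\<in>UNIV. ?E $ a $ i * coord_curv x i j a d) * ?W $ j $ b)"
    by (simp add: sum_distrib_left sum_distrib_right mult_ac)
  also have "\<dots> = (\<Sum>i\<in>UNIV. \<Sum>j\<in>UNIV. \<Sum>l\<in>UNIV. ?F i j i l * (?W $ j $ b * ?W $ l $ d))"
    by (simp add: contr sum_distrib_left sum_distrib_right mult_ac)
  also have "\<dots> = (\<Sum>j\<in>UNIV. \<Sum>l\<in>UNIV. \<Sum>i\<in>UNIV. ?F i j i l * (?W $ j $ b * ?W $ l $ d))"
    by (subst sum.swap, rule sum.cong[OF refl], rule sum.swap)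
  finally show ?thesis
    by (simp add: sum_distrib_right)
qed

lemma trace_inv_metric:
  assumes x: "x \<in> U"
  shows "(\<Sum>b\<in>UNIV. \<Sum>d\<in>UNIV. inv_metric g x $ b $ d * g x $ b $ d) = real CARD('n)"
proof -
  let ?K = "diag (\<lambda>i. 1 / h x i)"
  have "transpose (g x) = g x"
    by (simp add: g_eq[OF x] matrix_transpose_mul diag_transpose matrix_mul_assoc)
  then have "(\<Sum>b\<in>UNIV. \<Sum>d\<in>UNIV. inv_metric g x $ b $ d * g x $ b $ d) = trace (inv_metric g x ** g x)"
    by (simp add: trace_def matrix_matrix_mult_def vec_eq_iff transpose_def)
  also have "inv_metric g x ** g x =
      E x ** (?K ** (transpose (E x) ** transpose (W x)) ** diag (h x)) ** W x"
    by (simp add: inv_metric_eq[OF x] g_eq[OF x] matrix_mul_assoc)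
  also have "transpose (E x) ** transpose (W x) = mat 1"
    by (metis W_E[OF x] matrix_transpose_mul transpose_mat)
  finally show ?thesis
    using h_nz[OF x] by (simp add: diag_diag diag_1 E_W[OF x] trace_I)
qed

definition space_form :: "real^'n \<Rightarrow> 'n \<Rightarrow> 'n \<Rightarrow> 'n \<Rightarrow> 'n \<Rightarrow> real" where
  "space_form x i j k l = h x i * h x j * ((if i = k \<and> j = l then 1 else 0) - (if i = l \<and> j = k then 1 else 0))"

lemma space_form_eq:
  assumes x: "x \<in> U"
  shows "g x $ a $ c * g x $ b $ d - g x $ a $ d * g x $ b $ c =
    (\<Sum>i\<in>UNIV. \<Sum>j\<in>UNIV. \<Sum>k\<in>UNIV. \<Sum>l\<in>UNIV.
      space_form x i j k l * (W x $ i $ a * W x $ j $ b * (W x $ k $ c * W x $ l $ d)))"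
proof -
  let ?W = "W x"
  have eq: "(if i = k \<and> j = l then 1 else 0) = (if l = j then if k = i then 1 else 0 else (0::real))"
 for i j k l :: 'n
    by auto
  have pull: "(\<Sum>l\<in>A. if P then f l else 0) = (if P then sum f A else (0::real))" for P f and A :: "'n set"
    by simp
  show ?thesis
    unfolding g_comp[OF x] space_form_def sum_product eq
    by (simp add: left_diff_distrib right_diff_distrib sum_subtractf mult_delta_left mult_delta_right pull)
       (simp add: mult_ac)
qed

text \<open>For an Einstein metric the Ricci and scalar terms of the Weyl tensor merge into one
  multiple of the tensor of constant curvature.\<close>

lemma weyl_einstein:
  assumes x: "x \<in> U" and n: "CARD('n) > 2"
    and einstein: "\<And>j l. (\<Sum>i\<in>UNIV. frame_curv (om x) (d_om x) i j i l) = (if j = l then \<Lambda> * h x j else 0)"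
  shows "bimat (\<lambda>a b c d. weyl g a b c d x) = transpose (kron (W x)) **
    bimat (\<lambda>i j k l. h x i * frame_curv (om x) (d_om x) i j k l - \<Lambda> / (real CARD('n) - 1) * space_form x i j k l) ** kron (W x)"
proof -
  have ricci: "ricci g b d x = \<Lambda> * g x $ b $ d" for b d
    by (simp add: ricci_eq[OF x] einstein g_comp[OF x] mult_delta_left) (simp add: sum_distrib_left mult_ac)
  have scal: "scalar_curvature g x = \<Lambda> * real CARD('n)"
    unfolding scalar_curvature_def trace_inv_metric[OF x, symmetric]
    by (simp add: ricci sum_distrib_left mult_ac)
  have "weyl g a b c d x = riemann g a b c d x
      - \<Lambda> / (real CARD('n) - 1) * (g x $ a $ c * g x $ b $ d - g x $ a $ d * g x $ b $ c)" for a b c d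
  proof -
    \<comment> \<open>The coefficient is \<open>2/(N-2) - N/((N-1)(N-2)) = 1/(N-1)\<close>.\<close>
    have *: "y - (p * (\<Lambda> * s) - q * (\<Lambda> * t) - t * (\<Lambda> * q) + s * (\<Lambda> * p)) / (N - 2)
        + \<Lambda> * N * (p * s - q * t) / ((N - 1) * (N - 2)) = y - \<Lambda> / (N - 1) * (p * s - q * t)"
      if "N > 2" for y p q s t N :: real
      using that by (simp add: divide_simps) (simp add: algebra_simps)
    show ?thesis
      unfolding weyl_def ricci scal by (rule *) (use n in simp)
  qed
  then have "weyl g a b c d x = (transpose (kron (W x)) **
    bimat (\<lambda>i j k l. h x i * frame_curv (om x) (d_om x) i j k l - \<Lambda> / (real CARD('n) - 1) * space_form x i j k l) ** kron (W x))
      $ (a, b) $ (c, d)" for a b c d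
    unfolding riemann_eq[OF x] space_form_eq[OF x] kron_pullback sum_distrib_left
    by (simp add: left_diff_distrib sum_subtractf mult.assoc)
  then show ?thesis
    by (simp add: vec_eq_iff bimat_def)
qed

lemma kron_inv_metric:
  assumes x: "x \<in> U"
  shows "kron (inv_metric g x) = kron (E x) ** diag (\<lambda>p. 1 / (h x (fst p) * h x (snd p))) ** transpose (kron (E x))"
  by (simp add: inv_metric_eq[OF x] kron_mult kron_diag kron_transpose)

lemma kron_W_E:
  assumes x: "x \<in> U"
  shows "kron (W x) ** kron (E x) = mat 1" "transpose (kron (E x)) ** transpose (kron (W x)) = mat 1"
  using W_E[OF x] by (simp_all flip: kron_mult kron_transpose matrix_transpose_mul add: kron_mat_1)

text \<open>Each factor \<open>W\<close> meets a factor \<open>E\<close> of the inverse metric, the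
  outermost pair by cyclicity of the trace. Only the diagonal weights survive.\<close>

lemma contract4_frame:
  assumes x: "x \<in> U"
    and S: "bimat (\<lambda>a b c d. S a b c d x) = transpose (kron (W x)) ** bimat S' ** kron (W x)"
    and Q: "bimat (\<lambda>a b c d. Q a b c d x) = transpose (kron (W x)) ** bimat Q' ** kron (W x)"
  shows "contract4 g S Q x = (\<Sum>i\<in>UNIV. \<Sum>j\<in>UNIV. \<Sum>k\<in>UNIV. \<Sum>l\<in>UNIV.
    S' i j k l * Q' i j k l / (h x i * h x j * h x k * h x l))"
proof -
  let ?W = "kron (W x)" and ?E = "kron (E x)" and ?D = "diag (\<lambda>p. 1 / (h x (fst p) * h x (snd p)))"
  note WE = kron_W_E[OF x]
  have "contract4 g S Q x = trace (transpose ?W ** (transpose (bimat S') ** (?W ** ?E) ** ?D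
      ** (transpose ?E ** transpose ?W) ** bimat Q' ** (?W ** ?E) ** ?D ** transpose ?E))"
    unfolding contract4_trace S Q kron_inv_metric[OF x]
    by (simp add: matrix_transpose_mul diag_transpose matrix_mul_assoc)
  also have "\<dots> = trace ((transpose (bimat S') ** ?D ** bimat Q' ** ?D) ** (transpose ?E ** transpose ?W))"
    unfolding WE matrix_mul_rid by (subst trace_mul_sym) (simp add: WE flip: matrix_mul_assoc)
  also have "\<dots> = (\<Sum>q\<in>UNIV. \<Sum>p\<in>UNIV. S' (fst p) (snd p) (fst q) (snd q) * Q' (fst p) (snd p) (fst q) (snd q) /
      (h x (fst p) * h x (snd p) * h x (fst q) * h x (snd q)))"
    unfolding WE matrix_mul_rid
    by (simp add: trace_def mult_diag mult_diag_mult transpose_def bimat_def sum_distrib_right sum_divide_distrib mult_ac)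
  also have "\<dots> = (\<Sum>p\<in>UNIV. \<Sum>q\<in>UNIV. S' (fst p) (snd p) (fst q) (snd q) * Q' (fst p) (snd p) (fst q) (snd q) /
      (h x (fst p) * h x (snd p) * h x (fst q) * h x (snd q)))"
    by (rule sum.swap)
  finally show ?thesis
    by (simp add: sum_UNIV_prod)
qed

lemma contract1_frame:
  assumes x: "x \<in> U"
    and u: "\<And>a. u a x = (\<Sum>i\<in>UNIV. u' i * W x $ i $ a)"
    and v: "\<And>a. v a x = (\<Sum>i\<in>UNIV. v' i * W x $ i $ a)"
  shows "contract1 g u v x = (\<Sum>i\<in>UNIV. u' i * v' i / h x i)"
proof -
  have aux: "(\<Sum>a\<in>UNIV. E x $ a $ i * (\<Sum>j\<in>UNIV. w j * W x $ j $ a)) = w i" for w i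
  proof -
    have "(\<Sum>a\<in>UNIV. E x $ a $ i * (\<Sum>j\<in>UNIV. w j * W x $ j $ a)) =
        (\<Sum>a\<in>UNIV. \<Sum>j\<in>UNIV. w j * (W x $ j $ a * E x $ a $ i))"
      by (simp add: sum_distrib_left mult_ac)
    also have "\<dots> = (\<Sum>j\<in>UNIV. w j * (\<Sum>a\<in>UNIV. W x $ j $ a * E x $ a $ i))"
      by (subst sum.swap) (simp add: sum_distrib_left)
    finally show ?thesis
      by (simp add: W_E_sum[OF x] mult_delta_right)
  qed
  have "contract1 g u v x = (\<Sum>a\<in>UNIV. \<Sum>b\<in>UNIV. \<Sum>i\<in>UNIV. (E x $ a $ i * u a x) * (E x $ b $ i * v b x) / h x i)"
    by (simp add: contract1_def inv_metric_comp[OF x] sum_distrib_left sum_distrib_right mult_ac)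
  also have "\<dots> = (\<Sum>a\<in>UNIV. \<Sum>i\<in>UNIV. \<Sum>b\<in>UNIV. (E x $ a $ i * u a x) * (E x $ b $ i * v b x) / h x i)"
    by (rule sum.cong[OF refl], rule sum.swap)
  also have "\<dots> = (\<Sum>i\<in>UNIV. \<Sum>a\<in>UNIV. \<Sum>b\<in>UNIV. (E x $ a $ i * u a x) * (E x $ b $ i * v b x) / h x i)"
    by (rule sum.swap)
  also have "\<dots> = (\<Sum>i\<in>UNIV. (\<Sum>a\<in>UNIV. E x $ a $ i * u a x) * (\<Sum>b\<in>UNIV. E x $ b $ i * v b x) / h x i)"
    by (simp add: sum_product sum_divide_distrib)
  finally show ?thesis
    by (simp add: u v aux)
qed

end

section \<open>The Levi-Civita symbol\<close>

text \<open>Used in two ways: as an index tuple regarded as a self-map of the type \<open>4\<close>,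
  and, nested, as a table of components. The else branch is the index \<open>4\<close>.\<close>

definition quad :: "'a \<Rightarrow> 'a \<Rightarrow> 'a \<Rightarrow> 'a \<Rightarrow> 4 \<Rightarrow> 'a" where
  "quad a b c d i = (if i = 1 then a else if i = 2 then b else if i = 3 then c else d)"

lemma quad_simps [simp]: "quad a b c d 1 = a" "quad a b c d 2 = b" "quad a b c d 3 = c" "quad a b c d 4 = d"
  by (simp_all add: quad_def)

lemma quad_eta: "quad (p 1) (p 2) (p 3) (p 4) = p"
proof
  fix i :: 4
  show "quad (p 1) (p 2) (p 3) (p 4) i = p i"
    using UNIV_4 by (auto simp: quad_def)
qed

lemma inj_quad: "inj (quad a b c d) \<longleftrightarrow> distinct [a, b, c, d]"
  unfolding inj_def forall_4 by auto

lemma permutes_UNIV_iff_inj: "p permutes (UNIV :: 'a::finite set) \<longleftrightarrow> inj p"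
proof
  assume "inj p"
  then have "bij p"
    by (simp add: bij_betw_def finite_UNIV_inj_surj)
  then show "p permutes UNIV"
    by (rule bij_imp_permutes) simp
qed (rule permutes_inj)

lemma prod_4: "prod f (UNIV :: 4 set) = f 1 * f 2 * f 3 * f 4"
  unfolding UNIV_4 by (simp add: mult.assoc)

lemma levi_civita_symbol_quad:
  "levi_civita_symbol a b c d = (if quad a b c d permutes UNIV then of_int (sign (quad a b c d)) else 0)"
  unfolding levi_civita_symbol_def permutes_UNIV_iff_inj inj_quad by (simp add: quad_def[abs_def])

text \<open>Tuples that are not permutations drop out, and the rest is the Leibniz formula for the
  matrix with columns \<open>a\<close>, \<open>b\<close>, \<open>c\<close>, \<open>d\<close> of
  \<open>A\<close>: either these are a permutation of all columns, or two of them coincide.\<close>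

lemma levi_civita_symbol_det:
  fixes A :: "real^4^4"
  shows "(\<Sum>i\<in>UNIV. \<Sum>j\<in>UNIV. \<Sum>k\<in>UNIV. \<Sum>l\<in>UNIV.
      levi_civita_symbol i j k l * (A $ i $ a * A $ j $ b * (A $ k $ c * A $ l $ d)))
    = det A * levi_civita_symbol a b c d"
proof -
  define q where "q = quad a b c d"
  have "(\<Sum>i\<in>UNIV. \<Sum>j\<in>UNIV. \<Sum>k\<in>UNIV. \<Sum>l\<in>UNIV.
      levi_civita_symbol i j k l * (A $ i $ a * A $ j $ b * (A $ k $ c * A $ l $ d))) =
    (\<Sum>(i, j, k, l)\<in>UNIV.
      levi_civita_symbol i j k l * (A $ i $ a * A $ j $ b * (A $ k $ c * A $ l $ d)))"
    by (simp add: sum_UNIV_prod)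
  also have "\<dots> = (\<Sum>(i, j, k, l) | quad i j k l permutes UNIV.
      levi_civita_symbol i j k l * (A $ i $ a * A $ j $ b * (A $ k $ c * A $ l $ d)))"
    by (rule sum.mono_neutral_right) (auto simp: levi_civita_symbol_quad split: if_splits)
  also have "\<dots> = (\<Sum>p | p permutes UNIV. of_int (sign p) * (\<Prod>n\<in>UNIV. A $ p n $ q n))"
    by (rule sum.reindex_bij_witness[where
        j = "\<lambda>(i, j, k, l). quad i j k l" and i = "\<lambda>p. (p 1, p 2, p 3, p 4)"])
      (auto simp: levi_civita_symbol_quad quad_eta prod_4 q_def mult_ac)
  also have "\<dots> = det (\<chi> n i. A $ i $ q n)"
    by (simp add: det_def)
  also have "\<dots> = det A * levi_civita_symbol a b c d"
  proof (cases "q permutes UNIV")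
    case True
    have "(\<chi> n i. A $ i $ q n) = (\<chi> n. transpose A $ q n)"
      by (simp add: transpose_def vec_eq_iff)
    then show ?thesis
      using True by (simp add: det_permute_rows levi_civita_symbol_quad q_def)
  next
    case False
    then obtain n m where "n \<noteq> m" "q n = q m"
      unfolding permutes_UNIV_iff_inj inj_def by auto
    then show ?thesis
      using det_identical_rows[of n m "\<chi> n i. A $ i $ q n"] False
      by (simp add: row_def levi_civita_symbol_quad q_def)
  qed
  finally show ?thesis .
qed

lemma levi_civita_symbol_1234: "levi_civita_symbol 1 2 3 4 = 1"
proof -
  have "quad 1 2 3 4 = id"
    using quad_eta[of id] by simp
  then show ?thesis
    by (simp add: levi_civita_symbol_quad permutes_id sign_id)
qed

lemma levi_civita_symbol_transpose:
  assumes "i \<noteq> j" "quad a' b' c' d' = quad a b c d \<circ> Transposition.transpose i j"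
  shows "levi_civita_symbol a' b' c' d' = - levi_civita_symbol a b c d"
proof (cases "quad a b c d permutes UNIV")
  case True
  have t: "Transposition.transpose i j permutes UNIV"
    by (simp add: permutes_swap_id)
  have "sign (quad a b c d \<circ> Transposition.transpose i j) = - sign (quad a b c d)"
    using assms(1) True t
    by (subst sign_compose) (auto simp: sign_swap_id permutation_permutes intro: exI[of _ UNIV])
  then show ?thesis
    using True t assms(2) by (simp add: levi_civita_symbol_quad permutes_compose)
next
  case False
  then have "\<not> quad a' b' c' d' permutes UNIV"
    unfolding permutes_UNIV_iff_inj assms(2)
    by (metis bij_def bij_transpose comp_assoc comp_id inj_compose transpose_comp_involutory)
  then show ?thesis
    using False by (simp add: levi_civita_symbol_quad)
qed

lemma levi_civita_symbol_swap:
  "levi_civita_symbol b a c d = - levi_civita_symbol a b c d"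
  "levi_civita_symbol a c b d = - levi_civita_symbol a b c d"
  "levi_civita_symbol a b d c = - levi_civita_symbol a b c d"
  by (rule levi_civita_symbol_transpose[of 1 2] levi_civita_symbol_transpose[of 2 3]
      levi_civita_symbol_transpose[of 3 4];
      simp add: fun_eq_iff forall_4 Transposition.transpose_def)+

lemma levi_civita_symbol_eq_0: "\<not> distinct [a, b, c, d] \<Longrightarrow> levi_civita_symbol a b c d = 0"
  by (auto simp: levi_civita_symbol_def)

text \<open>A table for evaluating finite sums; each value is reached from the identity by swaps of
  adjacent indices.\<close>

lemma levi_civita_symbol_perm:
  "levi_civita_symbol 1 2 3 4 = 1" "levi_civita_symbol 1 2 4 3 = -1"
  "levi_civita_symbol 1 3 2 4 = -1" "levi_civita_symbol 1 3 4 2 = 1"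
  "levi_civita_symbol 1 4 2 3 = 1" "levi_civita_symbol 1 4 3 2 = -1"
  "levi_civita_symbol 2 1 3 4 = -1" "levi_civita_symbol 2 1 4 3 = 1"
  "levi_civita_symbol 2 3 1 4 = 1" "levi_civita_symbol 2 3 4 1 = -1"
  "levi_civita_symbol 2 4 1 3 = -1" "levi_civita_symbol 2 4 3 1 = 1"
  "levi_civita_symbol 3 1 2 4 = 1" "levi_civita_symbol 3 1 4 2 = -1"
  "levi_civita_symbol 3 2 1 4 = -1" "levi_civita_symbol 3 2 4 1 = 1"
  "levi_civita_symbol 3 4 1 2 = 1" "levi_civita_symbol 3 4 2 1 = -1"
  "levi_civita_symbol 4 1 2 3 = -1" "levi_civita_symbol 4 1 3 2 = 1"
  "levi_civita_symbol 4 2 1 3 = 1" "levi_civita_symbol 4 2 3 1 = -1"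
  "levi_civita_symbol 4 3 1 2 = -1" "levi_civita_symbol 4 3 2 1 = 1"
proof -
  note sw = levi_civita_symbol_swap
  show 1: "levi_civita_symbol 1 2 3 4 = 1" by (rule levi_civita_symbol_1234)
  show 2: "levi_civita_symbol 1 2 4 3 = -1" using sw(3)[of 1 2 4 3] 1 by simp
  show 3: "levi_civita_symbol 1 3 2 4 = -1" using sw(2)[of 1 3 2 4] 1 by simp
  show 4: "levi_civita_symbol 1 3 4 2 = 1" using sw(3)[of 1 3 4 2] 3 by simp
  show 5: "levi_civita_symbol 1 4 2 3 = 1" using sw(2)[of 1 4 2 3] 2 by simp
  show 6: "levi_civita_symbol 1 4 3 2 = -1" using sw(2)[of 1 4 3 2] 4 by simp
  show 7: "levi_civita_symbol 2 1 3 4 = -1" using sw(1)[of 2 1 3 4] 1 by simp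
  show 8: "levi_civita_symbol 2 1 4 3 = 1" using sw(1)[of 2 1 4 3] 2 by simp
  show 9: "levi_civita_symbol 3 1 2 4 = 1" using sw(1)[of 3 1 2 4] 3 by simp
  show 10: "levi_civita_symbol 3 1 4 2 = -1" using sw(1)[of 3 1 4 2] 4 by simp
  show 11: "levi_civita_symbol 4 1 2 3 = -1" using sw(1)[of 4 1 2 3] 5 by simp
  show 12: "levi_civita_symbol 4 1 3 2 = 1" using sw(1)[of 4 1 3 2] 6 by simp
  show 13: "levi_civita_symbol 2 3 1 4 = 1" using sw(2)[of 2 3 1 4] 7 by simp
  show 14: "levi_civita_symbol 2 4 1 3 = -1" using sw(2)[of 2 4 1 3] 8 by simp
  show 15: "levi_civita_symbol 3 2 1 4 = -1" using sw(2)[of 3 2 1 4] 9 by simp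
  show 16: "levi_civita_symbol 3 4 1 2 = 1" using sw(2)[of 3 4 1 2] 10 by simp
  show 17: "levi_civita_symbol 4 2 1 3 = 1" using sw(2)[of 4 2 1 3] 11 by simp
  show 18: "levi_civita_symbol 4 3 1 2 = -1" using sw(2)[of 4 3 1 2] 12 by simp
  show "levi_civita_symbol 2 3 4 1 = -1" using sw(3)[of 2 3 4 1] 13 by simp
  show "levi_civita_symbol 2 4 3 1 = 1" using sw(3)[of 2 4 3 1] 14 by simp
  show "levi_civita_symbol 3 2 4 1 = 1" using sw(3)[of 3 2 4 1] 15 by simp
  show "levi_civita_symbol 3 4 2 1 = -1" using sw(3)[of 3 4 2 1] 16 by simp
  show "levi_civita_symbol 4 2 3 1 = -1" using sw(3)[of 4 2 3 1] 17 by simp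
  show "levi_civita_symbol 4 3 2 1 = 1" using sw(3)[of 4 3 2 1] 18 by simp
qed

section \<open>The dual Weyl tensor in the frame\<close>

lemma matrix_scaleR_right: "A ** (k *\<^sub>R B) = k *\<^sub>R (A ** (B :: real^'n^'m))"
  by (simp add: matrix_scalar_ac scalar_matrix_assoc)

lemma weyl_dual_matrix:
  "bimat (\<lambda>a b c d. weyl_dual g a b c d x) = (sqrt \<bar>det (g x)\<bar> / 2) *\<^sub>R
    (bimat levi_civita_symbol ** kron (inv_metric g x) ** bimat (\<lambda>a b c d. weyl g a b c d x))"
  unfolding matrix_mul_assoc[symmetric]
  unfolding bimat_def kron_def matrix_matrix_mult_def weyl_dual_def levi_civita_def
  by (simp add: vec_eq_iff sum_UNIV_prod sum_distrib_left mult_ac)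

text \<open>Pulling back the symbol produces \<open>det (W x)\<close>, whereas the volume factor
  supplies only its absolute value. The quotient is the relative orientation of frame and
  chart.\<close>

lemma weyl_dual_frame:
  fixes g :: "real^4 \<Rightarrow> real^4^4"
  assumes "orthogonal_coframe g U W E h dW ddW om d_om"
    and x: "x \<in> U"
    and C: "bimat (\<lambda>a b c d. weyl g a b c d x) = transpose (kron (W x)) ** bimat C' ** kron (W x)"
  shows "bimat (\<lambda>a b c d. weyl_dual g a b c d x) = transpose (kron (W x)) **
    bimat (\<lambda>i j k l. sgn (det (W x)) * sqrt \<bar>\<Prod>i\<in>UNIV. h x i\<bar> / 2 * (\<Sum>m\<in>UNIV. \<Sum>n\<in>UNIV.
      levi_civita_symbol i j m n * C' m n k l / (h x m * h x n))) ** kron (W x)"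
proof -
  interpret orthogonal_coframe g U W E h dW ddW om d_om by fact
  let ?W = "kron (W x)" and ?E = "kron (E x)" and ?D = "diag (\<lambda>p. 1 / (h x (fst p) * h x (snd p)))"
  let ?\<epsilon> = "bimat levi_civita_symbol" and ?C = "bimat C'"
  have "det (W x) * det (E x) = 1"
    using arg_cong[OF W_E[OF x], of det] by (simp add: det_mul)
  then have "det (W x) \<noteq> 0" by auto
  have "det (diag (h x)) = (\<Prod>i\<in>UNIV. h x i)"
    by (subst det_diagonal) (auto simp: diag_def)
  then have "det (g x) = (det (W x))\<^sup>2 * (\<Prod>i\<in>UNIV. h x i)"
    by (simp add: g_eq[OF x] det_mul power2_eq_square)
  then have vol: "sqrt \<bar>det (g x)\<bar> = \<bar>det (W x)\<bar> * v" if "v = sqrt \<bar>\<Prod>i\<in>UNIV. h x i\<bar>" for v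
    by (simp add: abs_mult real_sqrt_mult that)
  define v where "v = sqrt \<bar>\<Prod>i\<in>UNIV. h x i\<bar>"
  have "transpose ?W ** ?\<epsilon> ** ?W = det (W x) *\<^sub>R ?\<epsilon>"
    using kron_pullback[of "W x" levi_civita_symbol] by (simp add: vec_eq_iff levi_civita_symbol_det bimat_def)
  then have \<epsilon>: "\<bar>det (W x)\<bar> *\<^sub>R ?\<epsilon> = sgn (det (W x)) *\<^sub>R (transpose ?W ** ?\<epsilon> ** ?W)"
    by (simp add: abs_sgn mult.commute)
  have "bimat (\<lambda>a b c d. weyl_dual g a b c d x) = (\<bar>det (W x)\<bar> *\<^sub>R ?\<epsilon>) **
      ((v / 2) *\<^sub>R (?E ** ?D ** (transpose ?E ** transpose ?W) ** ?C ** ?W))"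
    unfolding weyl_dual_matrix kron_inv_metric[OF x] C vol[OF v_def]
    by (simp add: matrix_scaleR_right scalar_matrix_assoc[symmetric] matrix_mul_assoc)
  also have "\<dots> = transpose ?W ** ((sgn (det (W x)) * v / 2) *\<^sub>R (?\<epsilon> ** (?W ** ?E) ** ?D ** ?C)) ** ?W"
    unfolding \<epsilon> kron_W_E(2)[OF x]
    by (simp add: matrix_scaleR_right scalar_matrix_assoc[symmetric] matrix_mul_assoc)
  also have "(sgn (det (W x)) * v / 2) *\<^sub>R (?\<epsilon> ** (?W ** ?E) ** ?D ** ?C) =
    bimat (\<lambda>i j k l. sgn (det (W x)) * sqrt \<bar>\<Prod>i\<in>UNIV. h x i\<bar> / 2 * (\<Sum>m\<in>UNIV. \<Sum>n\<in>UNIV.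
      levi_civita_symbol i j m n * C' m n k l / (h x m * h x n)))"
    unfolding kron_W_E[OF x] matrix_mul_rid
    by (simp add: vec_eq_iff mult_diag_mult sum_UNIV_prod) (simp add: bimat_def sum_UNIV_prod v_def)
  finally show ?thesis .
qed

section \<open>Curvature of metrics in Carter's form\<close>

text \<open>
  The connection coefficients are the solution of \<open>h\<^sub>i \<omega>\<^sup>i\<^sub>j\<^sub>k + h\<^sub>j \<omega>\<^sup>j\<^sub>i\<^sub>k = \<delta>\<^sub>i\<^sub>j e\<^sub>k h\<^sub>i\<close> (Koszul's formula) for the
  coframe above. \<open>R1\<close>, \<open>R2\<close> stand for the derivatives of \<open>R\<close> by \<open>r\<close>, and \<open>M1\<close>, \<open>M2\<close> for those of \<open>M\<close>
  by \<open>u\<close>; the last index of \<open>carter_d_om\<close> stands for the derivations \<open>0\<close>, \<open>R \<partial>\<^sub>r\<close>, \<open>M \<partial>\<^sub>u\<close>, \<open>0\<close>.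
\<close>

definition carter_om :: "real \<Rightarrow> real \<Rightarrow> real \<Rightarrow> real \<Rightarrow> real \<Rightarrow> real \<Rightarrow> real \<Rightarrow> real \<Rightarrow> 4 \<Rightarrow> 4 \<Rightarrow> 4 \<Rightarrow> real" where
  "carter_om a r u P R R1 M M1 = quad
    (quad (quad 0 (R1 / 2 - r * R / P) (- (a^2 * u * M / P)) 0)
      (quad (R1 / 2 - r * R / P) 0 0 (a * r * M / P))
      (quad (a^2 * u * M / P) 0 0 (- (a * u * M / P)))
      (quad 0 (a * r * M / P) (a * u * M / P) 0))
    (quad (quad (R1 / (2 * P^2) - r * R / P^3) 0 0 (a * r * M / P^3))
      (quad 0 (r * R / P + R1 / 2) (a^2 * u * M / P) 0)
      (quad 0 (a^2 * u * M / P) (- (r * M / P)) 0)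
      (quad (a * r * M / P^3) 0 0 (- (r * M / P^3))))
    (quad (quad (a^2 * u * R / P^3) 0 0 (- (a * u * R / P^3)))
      (quad 0 (- (a^2 * u * R / P)) (r * R / P) 0)
      (quad 0 (r * R / P) (a^2 * u * M / P + M1 / 2) 0)
      (quad (- (a * u * R / P^3)) 0 0 (a^2 * u * M / P^3 - M1 / (2 * P^2))))
    (quad (quad 0 (a * r * R / P) (a * u * R / P) 0)
      (quad (- (a * r * R / P)) 0 0 (r * R / P))
      (quad (a * u * R / P) 0 0 (M1 / 2 - a^2 * u * M / P))
      (quad 0 (- (r * R / P)) (M1 / 2 - a^2 * u * M / P) 0))"

definition carter_d_om :: "real \<Rightarrow> real \<Rightarrow> real \<Rightarrow> real \<Rightarrow> real \<Rightarrow> real \<Rightarrow> real \<Rightarrow> real \<Rightarrow> real \<Rightarrow> real \<Rightarrow>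
    4 \<Rightarrow> 4 \<Rightarrow> 4 \<Rightarrow> 4 \<Rightarrow> real" where
  "carter_d_om a r u P R R1 R2 M M1 M2 = quad
    (quad (quad (quad 0 0 0 0)
       (quad 0 (R * R2 / 2 + 2 * r^2 * R^2 / P^2 - R^2 / P - r * R * R1 / P) (2 * a^2 * r * u * R * M / P^2) 0)
       (quad 0 (2 * a^2 * r * u * R * M / P^2) (2 * a^4 * u^2 * M^2 / P^2 - a^2 * M^2 / P - a^2 * u * M * M1 / P) 0)
       (quad 0 0 0 0))
      (quad (quad 0 (R * R2 / 2 + 2 * r^2 * R^2 / P^2 - R^2 / P - r * R * R1 / P) (2 * a^2 * r * u * R * M / P^2) 0)
       (quad 0 0 0 0)
       (quad 0 0 0 0)
       (quad 0 (a * R * M / P - 2 * a * r^2 * R * M / P^2) (a * r * M * M1 / P - 2 * a^3 * r * u * M^2 / P^2) 0))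
      (quad (quad 0 (- (2 * a^2 * r * u * R * M / P^2))
         (a^2 * M^2 / P + a^2 * u * M * M1 / P - 2 * a^4 * u^2 * M^2 / P^2) 0)
       (quad 0 0 0 0)
       (quad 0 0 0 0)
       (quad 0 (2 * a * r * u * R * M / P^2) (2 * a^3 * u^2 * M^2 / P^2 - a * M^2 / P - a * u * M * M1 / P) 0))
      (quad (quad 0 0 0 0)
       (quad 0 (a * R * M / P - 2 * a * r^2 * R * M / P^2) (a * r * M * M1 / P - 2 * a^3 * r * u * M^2 / P^2) 0)
       (quad 0 (- (2 * a * r * u * R * M / P^2)) (a * M^2 / P + a * u * M * M1 / P - 2 * a^3 * u^2 * M^2 / P^2) 0)
       (quad 0 0 0 0)))
    (quad (quad (quad 0 (R * R2 / (2 * P^2) + 6 * r^2 * R^2 / P^4 - 3 * r * R * R1 / P^3 - R^2 / P^3)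
         (6 * a^2 * r * u * R * M / P^4 - 2 * a^2 * u * R1 * M / P^3) 0)
       (quad 0 0 0 0)
       (quad 0 0 0 0)
       (quad 0 (a * R * M / P^3 - 6 * a * r^2 * R * M / P^4) (a * r * M * M1 / P^3 - 6 * a^3 * r * u * M^2 / P^4) 0))
      (quad (quad 0 0 0 0)
       (quad 0 (R^2 / P + r * R * R1 / P + R * R2 / 2 - 2 * r^2 * R^2 / P^2) (- (2 * a^2 * r * u * R * M / P^2)) 0)
       (quad 0 (- (2 * a^2 * r * u * R * M / P^2))
         (a^2 * M^2 / P + a^2 * u * M * M1 / P - 2 * a^4 * u^2 * M^2 / P^2) 0)
       (quad 0 0 0 0))
      (quad (quad 0 0 0 0)
       (quad 0 (- (2 * a^2 * r * u * R * M / P^2))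
         (a^2 * M^2 / P + a^2 * u * M * M1 / P - 2 * a^4 * u^2 * M^2 / P^2) 0)
       (quad 0 (2 * r^2 * R * M / P^2 - R * M / P) (2 * a^2 * r * u * M^2 / P^2 - r * M * M1 / P) 0)
       (quad 0 0 0 0))
      (quad (quad 0 (a * R * M / P^3 - 6 * a * r^2 * R * M / P^4)
         (a * r * M * M1 / P^3 - 6 * a^3 * r * u * M^2 / P^4) 0)
       (quad 0 0 0 0)
       (quad 0 0 0 0)
       (quad 0 (6 * r^2 * R * M / P^4 - R * M / P^3) (6 * a^2 * r * u * M^2 / P^4 - r * M * M1 / P^3) 0)))
    (quad (quad (quad 0 (a^2 * u * R * R1 / P^3 - 6 * a^2 * r * u * R^2 / P^4)
         (a^2 * R * M / P^3 - 6 * a^4 * u^2 * R * M / P^4) 0)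
       (quad 0 0 0 0)
       (quad 0 0 0 0)
       (quad 0 (6 * a * r * u * R^2 / P^4 - a * u * R * R1 / P^3) (6 * a^3 * u^2 * R * M / P^4 - a * R * M / P^3) 0))
      (quad (quad 0 0 0 0)
       (quad 0 (2 * a^2 * r * u * R^2 / P^2 - a^2 * u * R * R1 / P) (2 * a^4 * u^2 * R * M / P^2 - a^2 * R * M / P) 0)
       (quad 0 (R^2 / P + r * R * R1 / P - 2 * r^2 * R^2 / P^2) (- (2 * a^2 * r * u * R * M / P^2)) 0)
       (quad 0 0 0 0))
      (quad (quad 0 0 0 0)
       (quad 0 (R^2 / P + r * R * R1 / P - 2 * r^2 * R^2 / P^2) (- (2 * a^2 * r * u * R * M / P^2)) 0)
       (quad 0 (- (2 * a^2 * r * u * R * M / P^2))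
         (a^2 * M^2 / P + a^2 * u * M * M1 / P + M * M2 / 2 - 2 * a^4 * u^2 * M^2 / P^2) 0)
       (quad 0 0 0 0))
      (quad (quad 0 (6 * a * r * u * R^2 / P^4 - a * u * R * R1 / P^3)
         (6 * a^3 * u^2 * R * M / P^4 - a * R * M / P^3) 0)
       (quad 0 0 0 0)
       (quad 0 0 0 0)
       (quad 0 (2 * r * R * M1 / P^3 - 6 * a^2 * r * u * R * M / P^4)
         (a^2 * M^2 / P^3 + 3 * a^2 * u * M * M1 / P^3 - 6 * a^4 * u^2 * M^2 / P^4 - M * M2 / (2 * P^2)) 0)))
    (quad (quad (quad 0 0 0 0)
       (quad 0 (a * R^2 / P + a * r * R * R1 / P - 2 * a * r^2 * R^2 / P^2) (- (2 * a^3 * r * u * R * M / P^2)) 0)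
       (quad 0 (a * u * R * R1 / P - 2 * a * r * u * R^2 / P^2) (a * R * M / P - 2 * a^3 * u^2 * R * M / P^2) 0)
       (quad 0 0 0 0))
      (quad (quad 0 (2 * a * r^2 * R^2 / P^2 - a * R^2 / P - a * r * R * R1 / P) (2 * a^3 * r * u * R * M / P^2) 0)
       (quad 0 0 0 0)
       (quad 0 0 0 0)
       (quad 0 (R^2 / P + r * R * R1 / P - 2 * r^2 * R^2 / P^2) (- (2 * a^2 * r * u * R * M / P^2)) 0))
      (quad (quad 0 (a * u * R * R1 / P - 2 * a * r * u * R^2 / P^2) (a * R * M / P - 2 * a^3 * u^2 * R * M / P^2) 0)
       (quad 0 0 0 0)
       (quad 0 0 0 0)
       (quad 0 (2 * a^2 * r * u * R * M / P^2)
         (M * M2 / 2 + 2 * a^4 * u^2 * M^2 / P^2 - a^2 * M^2 / P - a^2 * u * M * M1 / P) 0))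
      (quad (quad 0 0 0 0)
       (quad 0 (2 * r^2 * R^2 / P^2 - R^2 / P - r * R * R1 / P) (2 * a^2 * r * u * R * M / P^2) 0)
       (quad 0 (2 * a^2 * r * u * R * M / P^2)
         (M * M2 / 2 + 2 * a^4 * u^2 * M^2 / P^2 - a^2 * M^2 / P - a^2 * u * M * M1 / P) 0)
       (quad 0 0 0 0)))"

definition carter_h :: "real \<Rightarrow> real \<Rightarrow> real \<Rightarrow> 4 \<Rightarrow> real" where
  "carter_h P R M = quad (- (R / P)) (P * R) (P * M) (M / P)"

text \<open>
  With the volume element \<open>v\<close> of the frame, \<open>A\<close> and \<open>B / v\<close> are up to sign the real and imaginary part of
  the Weyl scalar \<open>\<Psi>\<^sub>2\<close>; the weight is \<open>2\<close> on the two blades of the type D structure and \<open>-1\<close> on mixed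
  planes, which makes the tensor trace-free.
\<close>

definition type_D_weight :: "4 \<Rightarrow> 4 \<Rightarrow> real" where
  "type_D_weight = quad (quad 0 2 (-1) (-1)) (quad 2 0 (-1) (-1)) (quad (-1) (-1) 0 2) (quad (-1) (-1) 2 0)"

definition type_D_weyl :: "(4 \<Rightarrow> real) \<Rightarrow> real \<Rightarrow> real \<Rightarrow> 4 \<Rightarrow> 4 \<Rightarrow> 4 \<Rightarrow> 4 \<Rightarrow> real" where
  "type_D_weyl h A B i j k l = type_D_weight i j *
    (A * (h i * h j * ((if i = k \<and> j = l then 1 else 0) - (if i = l \<and> j = k then 1 else 0)))
     + B * levi_civita_symbol i j k l)"

lemma zero_quad: "quad 0 0 0 0 k = (0::real)"
  by (simp add: quad_def)

lemma carter_om_deriv_r: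
  fixes a u M M1 :: real and R R1 R2 :: "real \<Rightarrow> real"
  assumes R: "(R has_real_derivative R1 r) (at r)" "(R1 has_real_derivative R2 r) (at r)"
    and nz: "r^2 + a^2 * u^2 \<noteq> 0" "R r \<noteq> 0"
  shows "((\<lambda>r. carter_om a r u (r^2 + a^2 * u^2) (R r) (R1 r) M M1 i j k) has_real_derivative
    carter_d_om a r u (r^2 + a^2 * u^2) (R r) (R1 r) (R2 r) M M1 M2 i j k 2 / R r) (at r)"
proof -
  \<comment> \<open>All powers of \<open>1/P\<close> become powers of one function with
    \<open>Q' = - 2 r Q^2\<close>, so that products and powers are all that is left to
    differentiate.\<close>
  define Q where "Q = (\<lambda>r. inverse (r^2 + a^2 * u^2))"
  have Q: "(Q has_real_derivative - (2 * r * (Q r * Q r))) (at r)"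
    unfolding Q_def using nz(1) by (auto intro!: derivative_eq_intros simp: power2_eq_square)
  note Q_eq = Q_def[THEN fun_cong, symmetric]
  \<comment> \<open>Tried before the general quotient rule, this keeps the factor 1/2 from producing
    squared denominators.\<close>
  have half: "((\<lambda>r. f r / 2) has_real_derivative E) (at r)"
    if "(f has_real_derivative D) (at r)" "D / 2 = E" for f D E
    using DERIV_cdivide[OF that(1), of 2] that(2) by simp
  have "\<forall>i j k. ((\<lambda>r. carter_om a r u (r^2 + a^2 * u^2) (R r) (R1 r) M M1 i j k) has_real_derivative
    carter_d_om a r u (r^2 + a^2 * u^2) (R r) (R1 r) (R2 r) M M1 M2 i j k 2 / R r) (at r)"
    unfolding carter_om_def carter_d_om_def forall_4 quad_simps
    unfolding divide_inverse[of _ "_ ^ _"] divide_inverse[of _ "_ + _"] divide_inverse[of _ "_ * _ ^ _"]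
      inverse_mult_distrib power_inverse[symmetric] Q_eq
    by (simp only: zero_quad div_0 DERIV_const simp_thms,
      intro conjI; (rule half | rule derivative_eq_intros R Q refl)+;
      simp add: nz(2) field_simps power2_eq_square power3_eq_cube power4_eq_xxxx)
  then show ?thesis
    by blast
qed

lemma carter_om_deriv_u:
  fixes a r R R1 :: real and M M1 M2 :: "real \<Rightarrow> real"
  assumes M: "(M has_real_derivative M1 u) (at u)" "(M1 has_real_derivative M2 u) (at u)"
    and nz: "r^2 + a^2 * u^2 \<noteq> 0" "M u \<noteq> 0"
  shows "((\<lambda>u. carter_om a r u (r^2 + a^2 * u^2) R R1 (M u) (M1 u) i j k) has_real_derivative
    carter_d_om a r u (r^2 + a^2 * u^2) R R1 R2 (M u) (M1 u) (M2 u) i j k 3 / M u) (at u)"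
proof -
  define Q where "Q = (\<lambda>u. inverse (r^2 + a^2 * u^2))"
  have Q: "(Q has_real_derivative - (2 * a^2 * u * (Q u * Q u))) (at u)"
    unfolding Q_def using nz(1) by (auto intro!: derivative_eq_intros simp: power2_eq_square)
  note Q_eq = Q_def[THEN fun_cong, symmetric]
  have half: "((\<lambda>u. f u / 2) has_real_derivative E) (at u)"
    if "(f has_real_derivative D) (at u)" "D / 2 = E" for f D E
    using DERIV_cdivide[OF that(1), of 2] that(2) by simp
  have "\<forall>i j k. ((\<lambda>u. carter_om a r u (r^2 + a^2 * u^2) R R1 (M u) (M1 u) i j k) has_real_derivative
    carter_d_om a r u (r^2 + a^2 * u^2) R R1 R2 (M u) (M1 u) (M2 u) i j k 3 / M u) (at u)"
    unfolding carter_om_def carter_d_om_def forall_4 quad_simps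
    unfolding divide_inverse[of _ "_ ^ _"] divide_inverse[of _ "_ + _"] divide_inverse[of _ "_ * _ ^ _"]
      inverse_mult_distrib power_inverse[symmetric] Q_eq
    by (simp only: zero_quad div_0 DERIV_const simp_thms,
      intro conjI; (rule half | rule derivative_eq_intros M Q refl)+;
      simp add: nz(2) field_simps power2_eq_square power3_eq_cube power4_eq_xxxx)
  then show ?thesis
    by blast
qed

section \<open>The Kerr-(anti-)de Sitter coframe\<close>

lemma vector_4:
  "(vector [a, b, c, d] :: real^4) $ 1 = a" "(vector [a, b, c, d] :: real^4) $ 2 = b"
  "(vector [a, b, c, d] :: real^4) $ 3 = c" "(vector [a, b, c, d] :: real^4) $ 4 = d"
  by (simp_all add: vector_def)

lemma has_partial_polar:
  assumes "((\<lambda>r. F r (x $ 3)) has_real_derivative Dr) (at (x $ 2))"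
    and "((\<lambda>\<theta>. F (x $ 2) \<theta>) has_real_derivative D\<theta>) (at (x $ 3))"
  shows "has_partial c (\<lambda>y. F (y $ 2) (y $ 3)) (quad 0 Dr D\<theta> 0 c) x"
proof -
  have "\<forall>c. has_partial c (\<lambda>y. F (y $ 2) (y $ 3)) (quad 0 Dr D\<theta> 0 c) x"
    unfolding forall_4 has_partial_def using assms
    by (simp add: axis_def DERIV_shift[of "\<lambda>r. F r (x $ 3)" Dr 0 "x $ 2", simplified]
        DERIV_shift[of "\<lambda>\<theta>. F (x $ 2) \<theta>" D\<theta> 0 "x $ 3", simplified] add.commute)
  then show ?thesis ..
qed

definition kerr_R1 :: "real \<Rightarrow> real \<Rightarrow> real \<Rightarrow> real \<Rightarrow> real" where
  "kerr_R1 a \<Lambda> m r = - 4 * (\<Lambda> / 3) * r^3 + 2 * (1 - \<Lambda> / 3 * a^2) * r - 2 * m"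

definition kerr_R2 :: "real \<Rightarrow> real \<Rightarrow> real \<Rightarrow> real" where
  "kerr_R2 a \<Lambda> r = - 12 * (\<Lambda> / 3) * r^2 + 2 * (1 - \<Lambda> / 3 * a^2)"

definition kerr_M :: "real \<Rightarrow> real \<Rightarrow> real \<Rightarrow> real" where
  "kerr_M a \<Lambda> u = (1 + a^2 * (\<Lambda> / 3) * u^2) * (1 - u^2)"

definition kerr_M1 :: "real \<Rightarrow> real \<Rightarrow> real \<Rightarrow> real" where
  "kerr_M1 a \<Lambda> u = - 4 * a^2 * (\<Lambda> / 3) * u^3 - 2 * (1 - \<Lambda> / 3 * a^2) * u"

definition kerr_M2 :: "real \<Rightarrow> real \<Rightarrow> real \<Rightarrow> real" where
  "kerr_M2 a \<Lambda> u = - 12 * a^2 * (\<Lambda> / 3) * u^2 - 2 * (1 - \<Lambda> / 3 * a^2)"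

lemma Delta_r_deriv:
  "(Delta_r a \<Lambda> m has_real_derivative kerr_R1 a \<Lambda> m r) (at r)"
  "(kerr_R1 a \<Lambda> m has_real_derivative kerr_R2 a \<Lambda> r) (at r)"
  unfolding Delta_r_def[abs_def] kerr_R1_def[abs_def] kerr_R2_def
  by (auto intro!: derivative_eq_intros simp: field_simps power2_eq_square power3_eq_cube)

lemma kerr_M_deriv:
  "(kerr_M a \<Lambda> has_real_derivative kerr_M1 a \<Lambda> u) (at u)"
  "(kerr_M1 a \<Lambda> has_real_derivative kerr_M2 a \<Lambda> u) (at u)"
  unfolding kerr_M_def[abs_def] kerr_M1_def[abs_def] kerr_M2_def
  by (auto intro!: derivative_eq_intros simp: field_simps power2_eq_square power3_eq_cube)

lemma kerr_M_cos: "kerr_M a \<Lambda> (cos \<theta>) = Delta_theta a \<Lambda> \<theta> * (sin \<theta>)^2"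
  by (simp add: kerr_M_def Delta_theta_def sin_squared_eq)

definition kerr_dom :: "real \<Rightarrow> real \<Rightarrow> real \<Rightarrow> (real^4) set" where
  "kerr_dom a \<Lambda> m = {x. rho2 a (x $ 2) (x $ 3) \<noteq> 0 \<and> Delta_r a \<Lambda> m (x $ 2) \<noteq> 0
     \<and> Delta_theta a \<Lambda> (x $ 3) > 0 \<and> sin (x $ 3) \<noteq> 0}"

text \<open>The third row is \<open>du / M\<close> written in the chart coordinate \<theta>, whence
  the factor \<open>- sin\<close>.\<close>

definition kerr_W :: "real \<Rightarrow> real \<Rightarrow> real \<Rightarrow> real^4 \<Rightarrow> real^4^4" where
  "kerr_W a \<Lambda> m x = (\<chi> i c. quad
     (quad (1 / Xi a \<Lambda>) 0 0 (- a * (sin (x $ 3))^2 / Xi a \<Lambda>))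
     (quad 0 (1 / Delta_r a \<Lambda> m (x $ 2)) 0 0)
     (quad 0 0 (- sin (x $ 3) / kerr_M a \<Lambda> (cos (x $ 3))) 0)
     (quad (a / Xi a \<Lambda>) 0 0 (- ((x $ 2)^2 + a^2) / Xi a \<Lambda>)) i c)"

definition kerr_E :: "real \<Rightarrow> real \<Rightarrow> real \<Rightarrow> real^4 \<Rightarrow> real^4^4" where
  "kerr_E a \<Lambda> m x = (\<chi> c i. quad
     (quad (Xi a \<Lambda> * ((x $ 2)^2 + a^2) / rho2 a (x $ 2) (x $ 3)) 0 0
       (- Xi a \<Lambda> * a * (sin (x $ 3))^2 / rho2 a (x $ 2) (x $ 3)))
     (quad 0 (Delta_r a \<Lambda> m (x $ 2)) 0 0)
     (quad 0 0 (- kerr_M a \<Lambda> (cos (x $ 3)) / sin (x $ 3)) 0)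
     (quad (Xi a \<Lambda> * a / rho2 a (x $ 2) (x $ 3)) 0 0 (- Xi a \<Lambda> / rho2 a (x $ 2) (x $ 3))) c i)"

definition kerr_h :: "real \<Rightarrow> real \<Rightarrow> real \<Rightarrow> real^4 \<Rightarrow> 4 \<Rightarrow> real" where
  "kerr_h a \<Lambda> m x = carter_h (rho2 a (x $ 2) (x $ 3)) (Delta_r a \<Lambda> m (x $ 2)) (kerr_M a \<Lambda> (cos (x $ 3)))"

definition kerr_dW :: "real \<Rightarrow> real \<Rightarrow> real \<Rightarrow> real^4 \<Rightarrow> 4 \<Rightarrow> 4 \<Rightarrow> 4 \<Rightarrow> real" where
  "kerr_dW a \<Lambda> m x = (let r = x $ 2; s = sin (x $ 3); u = cos (x $ 3);
       R = Delta_r a \<Lambda> m r; R1 = kerr_R1 a \<Lambda> m r; M = kerr_M a \<Lambda> u; M1 = kerr_M1 a \<Lambda> u;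
       z = quad 0 0 0 0 in quad
     (quad z z z (quad 0 0 (- 2 * a * s * u / Xi a \<Lambda>) 0))
     (quad z (quad 0 (- R1 / R^2) 0 0) z z)
     (quad z z (quad 0 0 (- u / M - s^2 * M1 / M^2) 0) z)
     (quad z z z (quad 0 (- 2 * r / Xi a \<Lambda>) 0 0)))"

definition kerr_ddW :: "real \<Rightarrow> real \<Rightarrow> real \<Rightarrow> real^4 \<Rightarrow> 4 \<Rightarrow> 4 \<Rightarrow> 4 \<Rightarrow> 4 \<Rightarrow> real" where
  "kerr_ddW a \<Lambda> m x = (let r = x $ 2; s = sin (x $ 3); u = cos (x $ 3);
       R = Delta_r a \<Lambda> m r; R1 = kerr_R1 a \<Lambda> m r; R2 = kerr_R2 a \<Lambda> r;
       M = kerr_M a \<Lambda> u; M1 = kerr_M1 a \<Lambda> u; M2 = kerr_M2 a \<Lambda> u;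
       z = quad 0 0 0 0; zz = quad z z z z in quad
     (quad zz zz zz (quad z z (quad 0 0 (2 * a * (s^2 - u^2) / Xi a \<Lambda>) 0) z))
     (quad zz (quad z (quad 0 (2 * R1^2 / R^3 - R2 / R^2) 0 0) z z) zz zz)
     (quad zz zz (quad z z (quad 0 0 (s / M - 3 * s * u * M1 / M^2 + s^3 * M2 / M^2
        - 2 * s^3 * M1^2 / M^3) 0) z) zz)
     (quad zz zz zz (quad z (quad 0 (- 2 / Xi a \<Lambda>) 0 0) z z)))"

definition kerr_om :: "real \<Rightarrow> real \<Rightarrow> real \<Rightarrow> real^4 \<Rightarrow> 4 \<Rightarrow> 4 \<Rightarrow> 4 \<Rightarrow> real" where
  "kerr_om a \<Lambda> m x = (let r = x $ 2; u = cos (x $ 3) in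
     carter_om a r u (r^2 + a^2 * u^2) (Delta_r a \<Lambda> m r) (kerr_R1 a \<Lambda> m r) (kerr_M a \<Lambda> u) (kerr_M1 a \<Lambda> u))"

definition kerr_d_om :: "real \<Rightarrow> real \<Rightarrow> real \<Rightarrow> real^4 \<Rightarrow> 4 \<Rightarrow> 4 \<Rightarrow> 4 \<Rightarrow> 4 \<Rightarrow> real" where
  "kerr_d_om a \<Lambda> m x = (let r = x $ 2; u = cos (x $ 3) in
     carter_d_om a r u (r^2 + a^2 * u^2) (Delta_r a \<Lambda> m r) (kerr_R1 a \<Lambda> m r) (kerr_R2 a \<Lambda> r)
       (kerr_M a \<Lambda> u) (kerr_M1 a \<Lambda> u) (kerr_M2 a \<Lambda> u))"

lemma kerr_domD:
  assumes "x \<in> kerr_dom a \<Lambda> m"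
  shows "rho2 a (x $ 2) (x $ 3) \<noteq> 0" "(x $ 2)^2 + a^2 * (cos (x $ 3))^2 \<noteq> 0" "Delta_r a \<Lambda> m (x $ 2) \<noteq> 0"
    "sin (x $ 3) \<noteq> 0" "Delta_theta a \<Lambda> (x $ 3) \<noteq> 0" "kerr_M a \<Lambda> (cos (x $ 3)) \<noteq> 0" "kerr_M a \<Lambda> (cos (x $ 3)) > 0"
  using assms by (auto simp: kerr_dom_def kerr_M_cos rho2_def)

lemma open_kerr_dom: "open (kerr_dom a \<Lambda> m)"
  unfolding kerr_dom_def rho2_def Delta_r_def Delta_theta_def
  by (intro open_Collect_conj open_Collect_neq open_Collect_less continuous_intros)

lemma carter_d_om_zero: "carter_d_om a r u P R R1 R2 M M1 M2 i j k 1 = 0" "carter_d_om a r u P R R1 R2 M M1 M2 i j k 4 = 0"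
proof -
  have "\<forall>i j k. carter_d_om a r u P R R1 R2 M M1 M2 i j k 1 = 0 \<and> carter_d_om a r u P R R1 R2 M M1 M2 i j k 4 = 0"
    unfolding carter_d_om_def forall_4 quad_simps by simp
  then show "carter_d_om a r u P R R1 R2 M M1 M2 i j k 1 = 0" "carter_d_om a r u P R R1 R2 M M1 M2 i j k 4 = 0"
    by auto
qed

lemma kerr_metric_eq:
  assumes x: "x \<in> kerr_dom a \<Lambda> m" and "Xi a \<Lambda> \<noteq> 0"
  shows "kerr_dS_metric a \<Lambda> m x = transpose (kerr_W a \<Lambda> m x) ** diag (kerr_h a \<Lambda> m x) ** kerr_W a \<Lambda> m x"
  using kerr_domD[OF x] assms(2)
  by (simp add: vec_eq_iff forall_4 mult_diag_mult sum_4 transpose_def kerr_W_def kerr_dS_metric_def Let_def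
      vector_4 axis_def kerr_h_def carter_h_def kerr_M_cos)
     (simp add: field_simps power2_eq_square)

lemma kerr_W_E:
  assumes x: "x \<in> kerr_dom a \<Lambda> m" and "Xi a \<Lambda> \<noteq> 0"
  shows "kerr_W a \<Lambda> m x ** kerr_E a \<Lambda> m x = mat 1"
proof -
  define s where "s = sin (x $ 3)"
  define P where "P = rho2 a (x $ 2) (x $ 3)"
  \<comment> \<open>Eliminating \<open>r^2\<close> in favour of \<open>P\<close> makes
    \<open>r^2 + a^2 - a^2 s^2 = P\<close> automatic.\<close>
  have r: "(x $ 2)^2 = P - a^2 * (1 - s^2)"
    by (simp add: P_def rho2_def s_def cos_squared_eq)
  show ?thesis
    using kerr_domD[OF x] assms(2)
    by (simp add: vec_eq_iff forall_4 matrix_matrix_mult_def mat_def sum_4 kerr_W_def kerr_E_def r flip: s_def P_def)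
       (simp add: field_simps power2_eq_square)
qed

lemma kerr_W_partial:
  assumes x: "x \<in> kerr_dom a \<Lambda> m" and Xi: "Xi a \<Lambda> \<noteq> 0"
  shows "has_partial c (\<lambda>y. kerr_W a \<Lambda> m y $ i $ b) (kerr_dW a \<Lambda> m x i b c) x"
proof -
  note nz = kerr_domD[OF x]
  define F where "F r \<theta> i b = quad
     (quad (1 / Xi a \<Lambda>) 0 0 (- a * (sin \<theta>)^2 / Xi a \<Lambda>))
     (quad 0 (1 / Delta_r a \<Lambda> m r) 0 0)
     (quad 0 0 (- sin \<theta> / kerr_M a \<Lambda> (cos \<theta>)) 0)
     (quad (a / Xi a \<Lambda>) 0 0 (- (r^2 + a^2) / Xi a \<Lambda>)) i b" for r \<theta> i b
  note D = Delta_r_deriv(1)[THEN DERIV_chain2] kerr_M_deriv(1)[THEN DERIV_chain2]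
  have 1: "\<forall>i b. ((\<lambda>r. F r (x $ 3) i b) has_real_derivative kerr_dW a \<Lambda> m x i b 2) (at (x $ 2))"
    unfolding F_def forall_4 kerr_dW_def Let_def quad_simps
    using nz Xi
    by (auto intro!: derivative_eq_intros D simp: field_simps power2_eq_square)
  have 2: "\<forall>i b. ((\<lambda>\<theta>. F (x $ 2) \<theta> i b) has_real_derivative kerr_dW a \<Lambda> m x i b 3) (at (x $ 3))"
    unfolding F_def forall_4 kerr_dW_def Let_def quad_simps
    using nz Xi
    by (auto intro!: derivative_eq_intros D simp: field_simps power2_eq_square)
  have 3: "\<forall>i b. kerr_dW a \<Lambda> m x i b 1 = 0 \<and> kerr_dW a \<Lambda> m x i b 4 = 0"
    unfolding forall_4 kerr_dW_def Let_def quad_simps by simp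
  have "quad 0 (kerr_dW a \<Lambda> m x i b 2) (kerr_dW a \<Lambda> m x i b 3) 0 c = kerr_dW a \<Lambda> m x i b c"
    using 3 quad_eta[of "kerr_dW a \<Lambda> m x i b"] by simp
  with has_partial_polar[of "\<lambda>r \<theta>. F r \<theta> i b", OF 1[rule_format] 2[rule_format], of c] show ?thesis
    by (simp add: F_def kerr_W_def)
qed

lemma kerr_dW_partial:
  assumes x: "x \<in> kerr_dom a \<Lambda> m" and Xi: "Xi a \<Lambda> \<noteq> 0"
  shows "has_partial d (\<lambda>y. kerr_dW a \<Lambda> m y i b c) (kerr_ddW a \<Lambda> m x i b c d) x"
proof -
  note nz = kerr_domD[OF x]
  define F where "F r \<theta> = (let s = sin \<theta>; u = cos \<theta>;
       R = Delta_r a \<Lambda> m r; R1 = kerr_R1 a \<Lambda> m r; M = kerr_M a \<Lambda> u; M1 = kerr_M1 a \<Lambda> u;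
       z = quad 0 0 0 0 in quad
     (quad z z z (quad 0 0 (- 2 * a * s * u / Xi a \<Lambda>) 0))
     (quad z (quad 0 (- R1 / R^2) 0 0) z z)
     (quad z z (quad 0 0 (- u / M - s^2 * M1 / M^2) 0) z)
     (quad z z z (quad 0 (- 2 * r / Xi a \<Lambda>) 0 0)))" for r \<theta>
  note D = Delta_r_deriv[THEN DERIV_chain2] kerr_M_deriv[THEN DERIV_chain2]
  have 1: "\<forall>i b c. ((\<lambda>r. F r (x $ 3) i b c) has_real_derivative kerr_ddW a \<Lambda> m x i b c 2) (at (x $ 2))"
    unfolding F_def forall_4 kerr_ddW_def Let_def quad_simps
    using nz Xi
    by (auto intro!: derivative_eq_intros D simp: field_simps power2_eq_square power3_eq_cube)
  have 2: "\<forall>i b c. ((\<lambda>\<theta>. F (x $ 2) \<theta> i b c) has_real_derivative kerr_ddW a \<Lambda> m x i b c 3) (at (x $ 3))"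
    unfolding F_def forall_4 kerr_ddW_def Let_def quad_simps
    using nz Xi
    by (auto intro!: derivative_eq_intros D simp: field_simps power2_eq_square power3_eq_cube)
  have 3: "\<forall>i b c. kerr_ddW a \<Lambda> m x i b c 1 = 0 \<and> kerr_ddW a \<Lambda> m x i b c 4 = 0"
    unfolding forall_4 kerr_ddW_def Let_def quad_simps by simp
  have "quad 0 (kerr_ddW a \<Lambda> m x i b c 2) (kerr_ddW a \<Lambda> m x i b c 3) 0 d = kerr_ddW a \<Lambda> m x i b c d"
    using 3 quad_eta[of "kerr_ddW a \<Lambda> m x i b c"] by simp
  with has_partial_polar[of "\<lambda>r \<theta>. F r \<theta> i b c", OF 1[rule_format] 2[rule_format], of d] show ?thesis
    by (simp add: F_def kerr_dW_def Let_def)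
qed

lemma kerr_h_partial:
  assumes x: "x \<in> kerr_dom a \<Lambda> m"
  shows "has_partial c (\<lambda>y. kerr_h a \<Lambda> m y i)
    (2 * kerr_h a \<Lambda> m x i * conn (kerr_W a \<Lambda> m) (kerr_om a \<Lambda> m) x i i c) x"
proof -
  note nz = kerr_domD[OF x]
  define Pf where "Pf r \<theta> = r^2 + a^2 * (cos \<theta>)^2" for r \<theta>
  define F where "F r \<theta> = carter_h (Pf r \<theta>) (Delta_r a \<Lambda> m r) (kerr_M a \<Lambda> (cos \<theta>))" for r \<theta>
  note D = Delta_r_deriv[THEN DERIV_chain2] kerr_M_deriv[THEN DERIV_chain2]
  have Pf: "((\<lambda>r. Pf r (x $ 3)) has_real_derivative 2 * x $ 2) (at (x $ 2))"
     "((\<lambda>\<theta>. Pf (x $ 2) \<theta>) has_real_derivative - 2 * a^2 * cos (x $ 3) * sin (x $ 3)) (at (x $ 3))"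
    unfolding Pf_def by (auto intro!: derivative_eq_intros)
  have Pf0: "Pf (x $ 2) (x $ 3) \<noteq> 0"
    using nz by (simp add: Pf_def)
  define H where "H c i = 2 * kerr_h a \<Lambda> m x i * conn (kerr_W a \<Lambda> m) (kerr_om a \<Lambda> m) x i i c" for c i
  note H = H_def conn_def sum_4 kerr_h_def rho2_def carter_h_def kerr_W_def kerr_om_def carter_om_def Let_def
    Pf_def[symmetric]
  have 1: "\<forall>i. ((\<lambda>r. F r (x $ 3) i) has_real_derivative H 2 i) (at (x $ 2))"
    unfolding F_def forall_4 H quad_simps
    using nz(3,6) Pf0
    by (auto intro!: derivative_eq_intros D Pf simp: field_simps power2_eq_square)
  have 2: "\<forall>i. ((\<lambda>\<theta>. F (x $ 2) \<theta> i) has_real_derivative H 3 i) (at (x $ 3))"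
    unfolding F_def forall_4 H quad_simps
    using nz(3,6) Pf0
    by (auto intro!: derivative_eq_intros D Pf simp: field_simps power2_eq_square)
  have 3: "\<forall>i. H 1 i = 0 \<and> H 4 i = 0"
    unfolding forall_4 H_def conn_def sum_4 kerr_W_def kerr_om_def carter_om_def Let_def quad_simps by simp
  have "quad 0 (H 2 i) (H 3 i) 0 c = H c i"
    using 3 quad_eta[of "\<lambda>c. H c i"] by simp
  with has_partial_polar[of "\<lambda>r \<theta>. F r \<theta> i", OF 1[rule_format] 2[rule_format], of c] show ?thesis
    by (simp add: F_def H_def kerr_h_def rho2_def Pf_def)
qed

lemma kerr_om_partial:
  assumes x: "x \<in> kerr_dom a \<Lambda> m"
  shows "has_partial c (\<lambda>y. kerr_om a \<Lambda> m y i j k)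
    (\<Sum>l\<in>UNIV. kerr_d_om a \<Lambda> m x i j k l * kerr_W a \<Lambda> m x $ l $ c) x"
proof -
  note nz = kerr_domD[OF x]
  define F where "F r \<theta> = carter_om a r (cos \<theta>) (r^2 + a^2 * (cos \<theta>)^2) (Delta_r a \<Lambda> m r)
    (kerr_R1 a \<Lambda> m r) (kerr_M a \<Lambda> (cos \<theta>)) (kerr_M1 a \<Lambda> (cos \<theta>))" for r \<theta>
  have 1: "((\<lambda>r. F r (x $ 3) i j k) has_real_derivative kerr_d_om a \<Lambda> m x i j k 2 / Delta_r a \<Lambda> m (x $ 2)) (at (x $ 2))"
    unfolding F_def kerr_d_om_def Let_def
    by (rule carter_om_deriv_r) (use nz in \<open>auto intro: Delta_r_deriv\<close>)
  have 2: "((\<lambda>\<theta>. F (x $ 2) \<theta> i j k) has_real_derivative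
      kerr_d_om a \<Lambda> m x i j k 3 / kerr_M a \<Lambda> (cos (x $ 3)) * - sin (x $ 3)) (at (x $ 3))"
    unfolding F_def kerr_d_om_def Let_def
    by (rule DERIV_chain2[OF carter_om_deriv_u DERIV_cos]) (use nz in \<open>auto intro: kerr_M_deriv\<close>)
  have sum: "(\<Sum>l\<in>UNIV. kerr_d_om a \<Lambda> m x i j k l * kerr_W a \<Lambda> m x $ l $ c) =
      quad 0 (kerr_d_om a \<Lambda> m x i j k 2 / Delta_r a \<Lambda> m (x $ 2))
        (kerr_d_om a \<Lambda> m x i j k 3 / kerr_M a \<Lambda> (cos (x $ 3)) * - sin (x $ 3)) 0 c"
  proof -
    have "\<forall>c. (\<Sum>l\<in>UNIV. kerr_d_om a \<Lambda> m x i j k l * kerr_W a \<Lambda> m x $ l $ c) =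
      quad 0 (kerr_d_om a \<Lambda> m x i j k 2 / Delta_r a \<Lambda> m (x $ 2))
        (kerr_d_om a \<Lambda> m x i j k 3 / kerr_M a \<Lambda> (cos (x $ 3)) * - sin (x $ 3)) 0 c"
      unfolding forall_4 sum_4 kerr_W_def
      by (simp add: kerr_d_om_def Let_def carter_d_om_zero)
    then show ?thesis ..
  qed
  from has_partial_polar[of "\<lambda>r \<theta>. F r \<theta> i j k", OF 1 2, of c] show ?thesis
    unfolding sum by (simp add: F_def kerr_om_def Let_def)
qed

lemma kerr_E_partial:
  assumes x: "x \<in> kerr_dom a \<Lambda> m"
  shows "\<exists>D. has_partial c (\<lambda>y. kerr_E a \<Lambda> m y $ b $ i) D x"
proof -
  note nz = kerr_domD[OF x]
  define F where "F r \<theta> b i = quad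
     (quad (Xi a \<Lambda> * (r^2 + a^2) / (r^2 + a^2 * (cos \<theta>)^2)) 0 0
       (- Xi a \<Lambda> * a * (sin \<theta>)^2 / (r^2 + a^2 * (cos \<theta>)^2)))
     (quad 0 (Delta_r a \<Lambda> m r) 0 0)
     (quad 0 0 (- kerr_M a \<Lambda> (cos \<theta>) / sin \<theta>) 0)
     (quad (Xi a \<Lambda> * a / (r^2 + a^2 * (cos \<theta>)^2)) 0 0 (- Xi a \<Lambda> / (r^2 + a^2 * (cos \<theta>)^2))) b i" for r \<theta> b i
  note D = Delta_r_deriv[THEN DERIV_chain2] kerr_M_deriv[THEN DERIV_chain2]
  have sin_diff: "sin differentiable (at \<theta>)" and cos_diff: "cos differentiable (at \<theta>)" for \<theta> :: real
    unfolding real_differentiable_def by (blast intro: DERIV_sin DERIV_cos)+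
  have 1: "\<forall>b i. (\<lambda>r. F r (x $ 3) b i) differentiable (at (x $ 2))"
    unfolding F_def forall_4 quad_simps Delta_r_def kerr_M_def
    using nz by (auto intro!: derivative_intros)
  have 2: "\<forall>b i. (\<lambda>\<theta>. F (x $ 2) \<theta> b i) differentiable (at (x $ 3))"
    unfolding F_def forall_4 quad_simps Delta_r_def kerr_M_def
    using nz by (auto intro!: derivative_intros sin_diff cos_diff)
  from 1 2 obtain Dr D\<theta> where "((\<lambda>r. F r (x $ 3) b i) has_real_derivative Dr) (at (x $ 2))"
     "((\<lambda>\<theta>. F (x $ 2) \<theta> b i) has_real_derivative D\<theta>) (at (x $ 3))"
    unfolding real_differentiable_def by blast
  from has_partial_polar[of "\<lambda>r \<theta>. F r \<theta> b i", OF this, of c] show ?thesis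
    unfolding F_def kerr_E_def rho2_def by auto
qed

lemma carter_om_skew:
  assumes "P \<noteq> 0" "i \<noteq> j"
  shows "carter_h P R M i * carter_om a r u P R R1 M M1 i j k = - carter_h P R M j * carter_om a r u P R R1 M M1 j i k"
proof -
  have "\<forall>i j. i \<noteq> j \<longrightarrow> (\<forall>k. carter_h P R M i * carter_om a r u P R R1 M M1 i j k = - carter_h P R M j * carter_om a r u P R R1 M M1 j i k)"
    using assms(1) unfolding carter_om_def carter_h_def forall_4 quad_simps
    by (simp add: field_simps power2_eq_square power3_eq_cube)
  with assms(2) show ?thesis by blast
qed

\<comment> \<open>The unknowns become \<open>kerr_om\<close> and \<open>kerr_d_om\<close>. Given the
  coframe, the compatibility and torsion conditions leave no freedom for the connection.\<close>
schematic_goal kerr_coframe: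
  assumes Xi: "Xi a \<Lambda> \<noteq> 0"
  shows "orthogonal_coframe (kerr_dS_metric a \<Lambda> m) (kerr_dom a \<Lambda> m) (kerr_W a \<Lambda> m) (kerr_E a \<Lambda> m)
    (kerr_h a \<Lambda> m) (kerr_dW a \<Lambda> m) (kerr_ddW a \<Lambda> m) ?om ?d_om"
proof -
  have torsion: "kerr_dW a \<Lambda> m x i b c +
      (\<Sum>j\<in>UNIV. conn (kerr_W a \<Lambda> m) (kerr_om a \<Lambda> m) x i j c * kerr_W a \<Lambda> m x $ j $ b)
    = kerr_dW a \<Lambda> m x i c b +
      (\<Sum>j\<in>UNIV. conn (kerr_W a \<Lambda> m) (kerr_om a \<Lambda> m) x i j b * kerr_W a \<Lambda> m x $ j $ c)"
    if x: "x \<in> kerr_dom a \<Lambda> m" for x i b c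
  proof -
    define s where "s = sin (x $ 3)"
    define u where "u = cos (x $ 3)"
    define P where "P = (x $ 2)^2 + a^2 * u^2"
    define R where "R = Delta_r a \<Lambda> m (x $ 2)"
    define M where "M = kerr_M a \<Lambda> u"
    have s2: "s^2 = 1 - u^2" by (simp add: s_def u_def sin_squared_eq)
    have r: "(x $ 2)^2 = P - a^2 * u^2" by (simp add: P_def)
    \<comment> \<open>Rewriting \<open>s^2\<close> and \<open>r^2\<close> also inside products gives
      normal forms modulo the two relations among \<open>s\<close>, \<open>u\<close>,
      \<open>r\<close> and \<open>P\<close>.\<close>
    have ss: "s * s = 1 - u * u" "s * (s * y) = (1 - u * u) * y" for y
      using s2 by (simp_all add: power2_eq_square flip: mult.assoc)
    have rr: "x $ 2 * x $ 2 = P - a * a * (u * u)" "x $ 2 * (x $ 2 * y) = (P - a * a * (u * u)) * y" for y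
      using r by (simp_all add: power2_eq_square flip: mult.assoc)
    have "P \<noteq> 0" "R \<noteq> 0" "M \<noteq> 0" "s \<noteq> 0"
      using kerr_domD[OF x] by (simp_all add: P_def R_def M_def u_def s_def)
    then have "\<forall>i b c. kerr_dW a \<Lambda> m x i b c +
        (\<Sum>j\<in>UNIV. conn (kerr_W a \<Lambda> m) (kerr_om a \<Lambda> m) x i j c * kerr_W a \<Lambda> m x $ j $ b)
      = kerr_dW a \<Lambda> m x i c b +
        (\<Sum>j\<in>UNIV. conn (kerr_W a \<Lambda> m) (kerr_om a \<Lambda> m) x i j b * kerr_W a \<Lambda> m x $ j $ c)"
      using Xi
      unfolding forall_4 conn_def sum_4 kerr_dW_def kerr_W_def kerr_om_def carter_om_def Let_def
        s_def[symmetric] u_def[symmetric] P_def[symmetric] R_def[symmetric] M_def[symmetric]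
      by (simp, simp add: field_simps, simp add: field_simps power2_eq_square, simp add: ss rr algebra_simps)
    then show ?thesis by blast
  qed
  show "orthogonal_coframe (kerr_dS_metric a \<Lambda> m) (kerr_dom a \<Lambda> m) (kerr_W a \<Lambda> m) (kerr_E a \<Lambda> m)
    (kerr_h a \<Lambda> m) (kerr_dW a \<Lambda> m) (kerr_ddW a \<Lambda> m) (kerr_om a \<Lambda> m) (kerr_d_om a \<Lambda> m)"
  proof
    fix x :: "real^4" assume x: "x \<in> kerr_dom a \<Lambda> m"
    note nz = kerr_domD[OF x]
    show "kerr_dS_metric a \<Lambda> m x = transpose (kerr_W a \<Lambda> m x) ** diag (kerr_h a \<Lambda> m x) ** kerr_W a \<Lambda> m x"
      by (rule kerr_metric_eq[OF x Xi])
    show "kerr_W a \<Lambda> m x ** kerr_E a \<Lambda> m x = mat 1"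
      by (rule kerr_W_E[OF x Xi])
    have "\<forall>i. kerr_h a \<Lambda> m x i \<noteq> 0"
      using nz by (simp add: forall_4 kerr_h_def carter_h_def)
    then show "kerr_h a \<Lambda> m x i \<noteq> 0" for i ..
    show "has_partial c (\<lambda>y. kerr_W a \<Lambda> m y $ i $ b) (kerr_dW a \<Lambda> m x i b c) x" for i b c
      by (rule kerr_W_partial[OF x Xi])
    show "has_partial d (\<lambda>y. kerr_dW a \<Lambda> m y i b c) (kerr_ddW a \<Lambda> m x i b c d) x" for i b c d
      by (rule kerr_dW_partial[OF x Xi])
    have "\<forall>i b c d. kerr_ddW a \<Lambda> m x i b c d = kerr_ddW a \<Lambda> m x i b d c"
      unfolding forall_4 kerr_ddW_def Let_def quad_simps by simp
    then show "kerr_ddW a \<Lambda> m x i b c d = kerr_ddW a \<Lambda> m x i b d c" for i b c d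
      by blast
    show "\<exists>D. has_partial c (\<lambda>y. kerr_E a \<Lambda> m y $ b $ i) D x" for b i c
      by (rule kerr_E_partial[OF x])
    show "has_partial c (\<lambda>y. kerr_h a \<Lambda> m y i)
        (2 * kerr_h a \<Lambda> m x i * conn (kerr_W a \<Lambda> m) (kerr_om a \<Lambda> m) x i i c) x" for i c
      by (rule kerr_h_partial[OF x])
    show "has_partial c (\<lambda>y. kerr_om a \<Lambda> m y i j k)
        (\<Sum>l\<in>UNIV. kerr_d_om a \<Lambda> m x i j k l * kerr_W a \<Lambda> m x $ l $ c) x" for i j k c
      by (rule kerr_om_partial[OF x])
    show "kerr_h a \<Lambda> m x i * kerr_om a \<Lambda> m x i j k = - kerr_h a \<Lambda> m x j * kerr_om a \<Lambda> m x j i k"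
      if "i \<noteq> j" for i j k
      using carter_om_skew[OF _ that] nz unfolding kerr_h_def kerr_om_def rho2_def Let_def by simp
    show "kerr_dW a \<Lambda> m x i b c + (\<Sum>j\<in>UNIV. conn (kerr_W a \<Lambda> m) (kerr_om a \<Lambda> m) x i j c * kerr_W a \<Lambda> m x $ j $ b) =
       kerr_dW a \<Lambda> m x i c b + (\<Sum>j\<in>UNIV. conn (kerr_W a \<Lambda> m) (kerr_om a \<Lambda> m) x i j b * kerr_W a \<Lambda> m x $ j $ c)" for i b c
      by (rule torsion[OF x])
  qed (rule open_kerr_dom)
qed

section \<open>Einstein equation and frame curvature\<close>

definition kerr_A :: "real \<Rightarrow> real \<Rightarrow> real \<Rightarrow> real \<Rightarrow> real" where
  "kerr_A a m r u = m * r * (r^2 - 3 * (a * u)^2) / (r^2 + (a * u)^2)^3"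

definition kerr_B :: "real \<Rightarrow> real \<Rightarrow> real \<Rightarrow> real \<Rightarrow> real" where
  "kerr_B a m r u = m * (a * u) * (3 * r^2 - (a * u)^2) / (r^2 + (a * u)^2)^3"

text \<open>
  The values of \<open>A\<close>, \<open>B\<close>, \<open>R2\<close>, \<open>M2\<close> are those for which a Carter metric is Einstein. The letter \<open>Q\<close> for \<open>1/P\<close>
  matters: it is next to \<open>P\<close> in the term order, so that \<open>P * (Q * x) = x\<close> cancels within normal forms.
\<close>

schematic_goal carter_curv:
  fixes a r u P Q R R1 R2 M M1 M2 L A B :: real
  assumes PQ: "(r^2 + a^2 * u^2) * Q = 1" and P: "P * Q = 1" "inverse P = Q"
    and A: "A = L - ((R - a^2 * M) * (1 - 2 * a^2 * u^2 * Q) * Q^2 - (R1 * r + M1 * a^2 * u) * Q^2 / 2)"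
    and B: "B = Q^2 * a * (R1 * u - M1 * r) / 2 - 2 * a * r * u * (R - a^2 * M) * Q^3"
    and R2: "R2 = 2 * P * ((R - a^2 * M) * (4 * a^2 * u^2 * Q - 3) * Q^2 + 2 * r * R1 * Q^2 - 2 * A - L)"
    and M2: "M2 = 2 * P * ((R - a^2 * M) * (4 * a^2 * u^2 * Q - 1) * Q^2 + 2 * a^2 * u * M1 * Q^2 - 2 * A - L)"
  shows "carter_h P R M i * frame_curv (carter_om a r u P R R1 M M1) (carter_d_om a r u P R R1 R2 M M1 M2) i j k l =
     type_D_weyl (carter_h P R M) A ?B i j k l
      + L * (carter_h P R M i * carter_h P R M j * ((if i = k \<and> j = l then 1 else 0) - (if i = l \<and> j = k then 1 else 0)))"
proof -
  let ?L = "\<lambda>i j k l. carter_h P R M i *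
    frame_curv (carter_om a r u P R R1 M M1) (carter_d_om a r u P R R1 R2 M M1 M2) i j k l"
  \<comment> \<open>The unknown is \<open>B * R * M\<close>: the factor \<open>R * M\<close> is the
    volume element of the frame, as the four norms multiply to \<open>- (R * M)^2\<close>.\<close>
  let ?R = "\<lambda>i j k l. type_D_weyl (carter_h P R M) A (B * R * M) i j k l
    + L * (carter_h P R M i * carter_h P R M j *
      ((if i = k \<and> j = l then 1 else 0) - (if i = l \<and> j = k then 1 else 0)))"
  have p: "P * (Q * x) = x" for x
    using P by (simp add: mult.assoc[symmetric])
  note ac = algebra_simps power2_eq_square power3_eq_cube power4_eq_xxxx P(1) p add_divide_distrib diff_divide_distrib
  \<comment> \<open>Both sides are skew in the last two indices, so the six coordinate planes
    suffice.\<close>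
  have up: "\<forall>i j. ?L i j 1 2 = ?R i j 1 2" "\<forall>i j. ?L i j 1 3 = ?R i j 1 3" "\<forall>i j. ?L i j 1 4 = ?R i j 1 4"
    "\<forall>i j. ?L i j 2 3 = ?R i j 2 3" "\<forall>i j. ?L i j 2 4 = ?R i j 2 4" "\<forall>i j. ?L i j 3 4 = ?R i j 3 4"
    unfolding forall_4 frame_curv_def carter_om_def carter_d_om_def carter_h_def type_D_weyl_def
      type_D_weight_def sum_4 quad_simps
    unfolding divide_inverse inverse_mult_distrib power_inverse[symmetric] P(2)
    \<comment> \<open>With \<open>R2\<close>, \<open>M2\<close>, \<open>A\<close> and
      \<open>B\<close> inserted, what is left of the 96 equations is polynomial and follows from the
      relation between \<open>r\<close>, \<open>u\<close> and \<open>Q\<close>.\<close>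
    by ((intro conjI;
        (simp add: levi_civita_symbol_perm levi_civita_symbol_eq_0
          del: mult_cancel_left mult_cancel_right mult_eq_0_iff)?;
        (simp add: ac B R2 M2 A)?; (use PQ in algebra)?)+)
  have skew_L: "?L i j l k = - ?L i j k l" for i j k l
    by (subst frame_curv_skew) simp
  have skew_R: "?R i j l k = - ?R i j k l" for i j k l
    unfolding type_D_weyl_def by (subst levi_civita_symbol_swap(3)) (simp add: algebra_simps)
  have down: "?L i j l k = ?R i j l k" if "?L i j k l = ?R i j k l" for k l
    using that skew_L[of i j l k] skew_R[of i j l k] by linarith
  have diag: "?L i j k k = ?R i j k k" for k
    using skew_L[of i j k k] skew_R[of i j k k] by linarith
  note up = up[rule_format]
  have "\<forall>k l. ?L i j k l = ?R i j k l"
    unfolding forall_4 by (intro conjI diag up down[OF up(1)] down[OF up(2)] down[OF up(3)] down[OF up(4)]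
      down[OF up(5)] down[OF up(6)])
  then show "?L i j k l = ?R i j k l" by blast
qed

text \<open>The particular quartics \<open>R\<close> and \<open>M\<close> enter here: with
  \<open>L = \<Lambda> / 3\<close> they satisfy the four conditions of
  \<open>carter_curv\<close>.\<close>

lemma kerr_frame_curv:
  assumes x: "x \<in> kerr_dom a \<Lambda> m"
  defines "h \<equiv> kerr_h a \<Lambda> m x"
  defines "v \<equiv> Delta_r a \<Lambda> m (x $ 2) * kerr_M a \<Lambda> (cos (x $ 3))"
  shows "h i * frame_curv (kerr_om a \<Lambda> m x) (kerr_d_om a \<Lambda> m x) i j k l =
     type_D_weyl h (kerr_A a m (x $ 2) (cos (x $ 3))) (kerr_B a m (x $ 2) (cos (x $ 3)) * v) i j k l
      + \<Lambda> / 3 * (h i * h j * ((if i = k \<and> j = l then 1 else 0) - (if i = l \<and> j = k then 1 else 0)))"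
proof -
  define r where "r = x $ 2"
  define u where "u = cos (x $ 3)"
  define P where "P = r^2 + a^2 * u^2"
  define Q where "Q = inverse P"
  define L where "L = \<Lambda> / 3"
  define R where "R = Delta_r a \<Lambda> m r"
  define R1 where "R1 = kerr_R1 a \<Lambda> m r"
  define R2 where "R2 = kerr_R2 a \<Lambda> r"
  define M where "M = kerr_M a \<Lambda> u"
  define M1 where "M1 = kerr_M1 a \<Lambda> u"
  define M2 where "M2 = kerr_M2 a \<Lambda> u"
  define A where "A = kerr_A a m r u"
  define B where "B = kerr_B a m r u"
  have P0: "P \<noteq> 0"
    using kerr_domD(2)[OF x] by (simp add: P_def r_def u_def)
  have PQ: "P * Q = 1" "inverse P = Q" "P * (Q * y) = y" for y
    using P0 by (simp_all add: Q_def)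
  have A: "A = m * r * (r^2 - 3 * (a * u)^2) * Q^3" and B: "B = m * (a * u) * (3 * r^2 - (a * u)^2) * Q^3"
    by (simp_all add: A_def kerr_A_def B_def kerr_B_def Q_def P_def power_mult_distrib divide_inverse power_inverse)
  have R: "R = (1 - L * r^2) * (r^2 + a^2) - 2 * m * r"
    by (simp add: R_def Delta_r_def L_def)
  have R1: "R1 = - 4 * L * r^3 + 2 * (1 - L * a^2) * r - 2 * m"
    by (simp add: R1_def kerr_R1_def L_def)
  have R2: "R2 = - 12 * L * r^2 + 2 * (1 - L * a^2)"
    by (simp add: R2_def kerr_R2_def L_def)
  have M: "M = (1 + a^2 * L * u^2) * (1 - u^2)"
    by (simp add: M_def kerr_M_def L_def)
  have M1: "M1 = - 4 * a^2 * L * u^3 - 2 * (1 - L * a^2) * u"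
    by (simp add: M1_def kerr_M1_def L_def)
  have M2: "M2 = - 12 * a^2 * L * u^2 - 2 * (1 - L * a^2)"
    by (simp add: M2_def kerr_M2_def L_def)
  note ac = algebra_simps power2_eq_square power3_eq_cube power4_eq_xxxx PQ(1,3) add_divide_distrib diff_divide_distrib
  \<comment> \<open>\<open>Q\<close> occurs at most cubed, so multiplying by \<open>P^3\<close>
    clears it. \<open>P\<close> is expanded only after these cancellations; expanding it earlier
    would block them.\<close>
  have cancel: "y = z" if "P * P * P * y = P * P * P * z" for y z
    using that P0 by simp
  have eqA: "A = L - ((R - a^2 * M) * (1 - 2 * a^2 * u^2 * Q) * Q^2 - (R1 * r + M1 * a^2 * u) * Q^2 / 2)"
    by (rule cancel) (simp add: ac A, simp add: ac P_def R R1 M M1)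
  have eqB: "B = Q^2 * a * (R1 * u - M1 * r) / 2 - 2 * a * r * u * (R - a^2 * M) * Q^3"
    by (rule cancel) (simp add: ac B, simp add: ac P_def R R1 M M1)
  have eqR2: "R2 = 2 * P * ((R - a^2 * M) * (4 * a^2 * u^2 * Q - 3) * Q^2 + 2 * r * R1 * Q^2 - 2 * A - L)"
    by (rule cancel) (simp add: ac A, simp add: ac P_def R R1 R2 M M1)
  have eqM2: "M2 = 2 * P * ((R - a^2 * M) * (4 * a^2 * u^2 * Q - 1) * Q^2 + 2 * a^2 * u * M1 * Q^2 - 2 * A - L)"
    by (rule cancel) (simp add: ac A, simp add: ac P_def R R1 M M1 M2)
  have PQ': "(r^2 + a^2 * u^2) * Q = 1"
    using PQ(1) by (simp add: P_def)
  show ?thesis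
    using carter_curv[OF PQ' PQ(1,2) eqA eqB eqR2 eqM2, of i j k l]
    by (simp add: h_def kerr_h_def rho2_def kerr_om_def kerr_d_om_def v_def Let_def A_def B_def L_def R_def R1_def R2_def
      M_def M1_def M2_def P_def r_def u_def mult.assoc)
qed

section \<open>Type D Weyl tensors\<close>

text \<open>Each row of \<open>type_D_weight\<close> sums to zero and the symbol vanishes on a
  repeated index, so only the constant curvature part has a trace, with factor 4 - 1 = 3.\<close>

lemma type_D_einstein:
  assumes "\<And>i. h i \<noteq> 0"
    and F: "\<And>i j k l. h i * F i j k l = type_D_weyl h A B i j k l
      + L * (h i * h j * ((if i = k \<and> j = l then 1 else 0) - (if i = l \<and> j = k then 1 else 0)))"
  shows "(\<Sum>i\<in>UNIV. F i j i l) = (if j = l then 3 * L * h j else 0)"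
proof -
  have F': "F i j k l = (type_D_weyl h A B i j k l
      + L * (h i * h j * ((if i = k \<and> j = l then 1 else 0) - (if i = l \<and> j = k then 1 else 0)))) / h i" for i j k l
    using F[of i j k l] assms(1)[of i] by (simp add: field_simps)
  have "\<forall>j l. (\<Sum>i\<in>UNIV. F i j i l) = (if j = l then 3 * L * h j else 0)"
    unfolding forall_4 sum_4 F' type_D_weyl_def type_D_weight_def
    using assms(1) by (simp add: levi_civita_symbol_eq_0) (simp add: field_simps)?
  then show ?thesis by blast
qed

\<comment> \<open>The value is \<open>48 * (A * A' - B * B')\<close>. For fixed \<open>i\<close>,
  \<open>j\<close> the \<open>A\<close> part lives on the plane of \<open>i\<close>,
  \<open>j\<close> and the \<open>B\<close> part on the complementary one, so there are no mixed
  terms; each contributes in two orders. The squared weights add up to 24. The minus sign is the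
  Lorentzian one in the hypothesis on \<open>h\<close>.\<close>
schematic_goal type_D_contract:
  assumes v: "h 1 * h 2 * h 3 * h 4 = - (v * v)" and "v \<noteq> 0"
  shows "(\<Sum>i\<in>UNIV. \<Sum>j\<in>UNIV. \<Sum>k\<in>UNIV. \<Sum>l\<in>UNIV.
    type_D_weyl h A (B * v) i j k l * type_D_weyl h A' (B' * v) i j k l / (h i * h j * h k * h l)) =
    ?contraction"
proof -
  have nz: "h 1 \<noteq> 0" "h 2 \<noteq> 0" "h 3 \<noteq> 0" "h 4 \<noteq> 0"
    using assms by auto
  have h1: "h 1 = - (v * v) / (h 2 * h 3 * h 4)"
    using v nz by (simp add: field_simps)
  have "\<forall>i j. (\<Sum>k\<in>UNIV. \<Sum>l\<in>UNIV.
      type_D_weyl h A (B * v) i j k l * type_D_weyl h A' (B' * v) i j k l / (h i * h j * h k * h l)) =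
    2 * (type_D_weight i j)^2 * (A * A' - B * B')"
    unfolding forall_4 sum_4 type_D_weyl_def type_D_weight_def quad_simps
    using nz \<open>v \<noteq> 0\<close>
    by (simp add: levi_civita_symbol_eq_0 levi_civita_symbol_perm h1)
  then show "(\<Sum>i\<in>UNIV. \<Sum>j\<in>UNIV. \<Sum>k\<in>UNIV. \<Sum>l\<in>UNIV.
    type_D_weyl h A (B * v) i j k l * type_D_weyl h A' (B' * v) i j k l / (h i * h j * h k * h l)) =
    48 * (A * A' - B * B')"
    by (simp add: sum_4 type_D_weight_def)
qed

lemma type_D_weyl_skew: "type_D_weyl h A B j i k l = - type_D_weyl h A B i j k l"
proof -
  have "\<forall>i j. type_D_weight j i = type_D_weight i j"
    unfolding forall_4 type_D_weight_def quad_simps by simp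
  then have "type_D_weight j i = type_D_weight i j" by blast
  moreover have "(if j = k \<and> i = l then 1 else 0) - (if j = l \<and> i = k then 1 else 0) =
      - ((if i = k \<and> j = l then 1 else 0) - (if i = l \<and> j = k then 1 else (0::real)))"
    by (simp add: conj_commute)
  ultimately show ?thesis
    unfolding type_D_weyl_def levi_civita_symbol_swap(1)[of j i]
    by (simp only:, simp only: ring_distribs mult_minus_left mult_minus_right mult.commute minus_add_distrib)
qed

\<comment> \<open>Duality exchanges a plane with its complement, and complementary planes have equal
  weight; hence the form is preserved and \<open>A\<close>, \<open>B\<close> become
  \<open>- e * B\<close>, \<open>e * A\<close> (the latter times \<open>v\<close>).\<close>
schematic_goal type_D_dual:
  assumes v: "h 1 * h 2 * h 3 * h 4 = - (v * v)" and "v \<noteq> 0"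
  shows "e * v / 2 * (\<Sum>m\<in>UNIV. \<Sum>n\<in>UNIV.
      levi_civita_symbol i j m n * type_D_weyl h A (B * v) m n k l / (h m * h n)) =
    type_D_weyl h ?A ?B i j k l"
proof -
  let ?C = "type_D_weyl h A (B * v)" and ?D = "type_D_weyl h (- e * B) (e * A * v)"
  have nz: "h 1 \<noteq> 0" "h 2 \<noteq> 0" "h 3 \<noteq> 0" "h 4 \<noteq> 0"
    using assms by auto
  have vv: "v * v = - (h 1 * h 2 * h 3 * h 4)" "v * (v * y) = - (h 1 * h 2 * h 3 * h 4) * y" for y
    using v by (simp_all flip: mult.assoc)
  \<comment> \<open>One representative for each plane, paired with its complement and the sign of
    the symbol; the other index orders follow by skewness.\<close>
  have C:
     "\<forall>k l. e * v * ?C 3 4 k l = ?D 1 2 k l * (h 3 * h 4)"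
     "\<forall>k l. - e * v * ?C 2 4 k l = ?D 1 3 k l * (h 2 * h 4)"
     "\<forall>k l. e * v * ?C 2 3 k l = ?D 1 4 k l * (h 2 * h 3)"
     "\<forall>k l. e * v * ?C 1 4 k l = ?D 2 3 k l * (h 1 * h 4)"
     "\<forall>k l. - e * v * ?C 1 3 k l = ?D 2 4 k l * (h 1 * h 3)"
     "\<forall>k l. e * v * ?C 1 2 k l = ?D 3 4 k l * (h 1 * h 2)"
    unfolding forall_4 type_D_weyl_def type_D_weight_def quad_simps
    by (simp_all add: levi_civita_symbol_eq_0 levi_civita_symbol_perm) (simp_all add: algebra_simps vv)
  have C': "e * v * ?C m n k l / (h m * h n) = ?D i j k l"
    if "e * v * ?C m n k l = ?D i j k l * (h m * h n)" "h m \<noteq> 0" "h n \<noteq> 0" for i j m n k l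
    using that by simp
  have D0: "type_D_weyl h A B i i k l = 0" for A B i
    using type_D_weyl_skew[of h A B i i k l] by simp
  have "\<forall>i j. e * v / 2 * (\<Sum>m\<in>UNIV. \<Sum>n\<in>UNIV.
      levi_civita_symbol i j m n * ?C m n k l / (h m * h n)) = ?D i j k l"
    unfolding forall_4 sum_4
    using nz C[rule_format, of k l]
    by (simp add: levi_civita_symbol_eq_0 levi_civita_symbol_perm D0
      type_D_weyl_skew[of _ _ _ 2 1] type_D_weyl_skew[of _ _ _ 3 1] type_D_weyl_skew[of _ _ _ 4 1]
      type_D_weyl_skew[of _ _ _ 3 2] type_D_weyl_skew[of _ _ _ 4 2] type_D_weyl_skew[of _ _ _ 4 3])
      (simp add: field_simps)
  then show "e * v / 2 * (\<Sum>m\<in>UNIV. \<Sum>n\<in>UNIV.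
      levi_civita_symbol i j m n * type_D_weyl h A (B * v) m n k l / (h m * h n)) =
    type_D_weyl h (- e * B) (e * A * v) i j k l" by blast
qed

section \<open>Weyl tensor, its dual, and the invariants \<open>I1\<close> and
  \<open>I2\<close>\<close>

context
  fixes a \<Lambda> m :: real and x :: "real^4"
  assumes x: "x \<in> kerr_dom a \<Lambda> m" and Xi: "Xi a \<Lambda> \<noteq> 0"
begin

private abbreviation "A \<equiv> kerr_A a m (x $ 2) (cos (x $ 3))"
private abbreviation "B \<equiv> kerr_B a m (x $ 2) (cos (x $ 3))"
private abbreviation "v \<equiv> Delta_r a \<Lambda> m (x $ 2) * kerr_M a \<Lambda> (cos (x $ 3))"

lemma kerr_weyl:
  "bimat (\<lambda>i j k l. weyl (kerr_dS_metric a \<Lambda> m) i j k l x) =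
    transpose (kron (kerr_W a \<Lambda> m x)) ** bimat (type_D_weyl (kerr_h a \<Lambda> m x) A (B * v)) ** kron (kerr_W a \<Lambda> m x)"
proof -
  have "(\<Sum>i\<in>UNIV. frame_curv (kerr_om a \<Lambda> m x) (kerr_d_om a \<Lambda> m x) i j i l) =
      (if j = l then \<Lambda> * kerr_h a \<Lambda> m x j else 0)" for j l
    using type_D_einstein[OF orthogonal_coframe.h_nz[OF kerr_coframe[OF Xi] x] kerr_frame_curv[OF x], of j l]
    by simp
  from orthogonal_coframe.weyl_einstein[OF kerr_coframe[OF Xi] x _ this] show ?thesis
    by (simp add: kerr_frame_curv[OF x] orthogonal_coframe.space_form_def[OF kerr_coframe[OF Xi]])
qed

lemma kerr_h_prod: "kerr_h a \<Lambda> m x 1 * kerr_h a \<Lambda> m x 2 * kerr_h a \<Lambda> m x 3 * kerr_h a \<Lambda> m x 4 = - (v * v)"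
  using kerr_domD[OF x] by (simp add: kerr_h_def carter_h_def)

lemma kerr_v_nz: "v \<noteq> 0"
  using kerr_domD[OF x] by simp

lemma kerr_det_W: "det (kerr_W a \<Lambda> m x) = sin (x $ 3) * rho2 a (x $ 2) (x $ 3) / ((Xi a \<Lambda>)^2 * v)"
proof -
  have "det (kerr_W a \<Lambda> m x) = sin (x $ 3) * ((x $ 2)^2 + a^2 - a^2 * (sin (x $ 3))^2) / ((Xi a \<Lambda>)^2 * v)"
  proof -
    let ?W = "kerr_W a \<Lambda> m x"
    \<comment> \<open>The Leibniz formula, in the shape of a sum over index tuples that
      \<open>levi_civita_symbol_perm\<close> evaluates.\<close>
    have "det ?W = (\<Sum>i\<in>UNIV. \<Sum>j\<in>UNIV. \<Sum>k\<in>UNIV. \<Sum>l\<in>UNIV.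
        levi_civita_symbol i j k l * (?W $ i $ 1 * ?W $ j $ 2 * (?W $ k $ 3 * ?W $ l $ 4)))"
      by (simp add: levi_civita_symbol_det levi_civita_symbol_perm)
    also have "\<dots> = sin (x $ 3) * ((x $ 2)^2 + a^2 - a^2 * (sin (x $ 3))^2) / ((Xi a \<Lambda>)^2 * v)"
      using Xi kerr_v_nz
      by (simp add: levi_civita_symbol_perm levi_civita_symbol_eq_0 sum_4 kerr_W_def)
        (simp add: field_simps power2_eq_square)
    finally show ?thesis .
  qed
  also have "(x $ 2)^2 + a^2 - a^2 * (sin (x $ 3))^2 = rho2 a (x $ 2) (x $ 3)"
    by (simp add: rho2_def sin_squared_eq algebra_simps)
  finally show ?thesis .
qed

text \<open>The root of the product of the norms is the absolute value of \<open>v\<close>, while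
  \<open>det W\<close> has the sign of \<open>sin (x $ 3) * v\<close>. The sign of \<open>v\<close>
  thus recombines to \<open>v\<close> itself, and only that of the sine is left.\<close>

lemma kerr_weyl_dual:
  "bimat (\<lambda>i j k l. weyl_dual (kerr_dS_metric a \<Lambda> m) i j k l x) =
    transpose (kron (kerr_W a \<Lambda> m x)) **
    bimat (type_D_weyl (kerr_h a \<Lambda> m x) (- sgn (sin (x $ 3)) * B) (sgn (sin (x $ 3)) * A * v)) **
    kron (kerr_W a \<Lambda> m x)"
proof -
  have "rho2 a (x $ 2) (x $ 3) > 0"
    using kerr_domD(1)[OF x] by (simp add: rho2_def order_less_le)
  moreover have sgn_inv: "y / (sgn p * sgn q) = y * (sgn p * sgn q)" for y p q :: real
    by (simp add: sgn_if)
  ultimately have "sgn (det (kerr_W a \<Lambda> m x)) = sgn (sin (x $ 3)) * sgn v"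
    unfolding kerr_det_W using Xi by (simp add: sgn_mult sgn_divide power2_eq_square sgn_inv)
  moreover have "sqrt \<bar>\<Prod>i\<in>UNIV. kerr_h a \<Lambda> m x i\<bar> = \<bar>v\<bar>"
    unfolding prod_4 kerr_h_prod by (simp add: abs_mult)
  ultimately have e: "sgn (det (kerr_W a \<Lambda> m x)) * sqrt \<bar>\<Prod>i\<in>UNIV. kerr_h a \<Lambda> m x i\<bar> = sgn (sin (x $ 3)) * v"
    by (metis mult.assoc mult.commute abs_mult_sgn)
  show ?thesis
    unfolding weyl_dual_frame[OF kerr_coframe[OF Xi] x kerr_weyl] e type_D_dual[OF kerr_h_prod kerr_v_nz] ..
qed

lemma kerr_I1: "I1 (kerr_dS_metric a \<Lambda> m) x = 48 * (A^2 - B^2)"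
  unfolding I1_def orthogonal_coframe.contract4_frame[where S = "weyl _" and Q = "weyl _", OF kerr_coframe[OF Xi] x kerr_weyl kerr_weyl]
    type_D_contract[OF kerr_h_prod kerr_v_nz]
  by (simp add: power2_eq_square)

text \<open>The sign is that of \<open>det W * v\<close>: the Levi-Civita tensor is built with \<open>sqrt \<bar>det g\<bar>\<close>, irrespective of the
  orientation of the coframe.\<close>

lemma kerr_I2: "I2 (kerr_dS_metric a \<Lambda> m) x = - 96 * sgn (sin (x $ 3)) * (A * B)"
  unfolding I2_def orthogonal_coframe.contract4_frame[where S = "weyl_dual _" and Q = "weyl _", OF kerr_coframe[OF Xi] x kerr_weyl_dual kerr_weyl]
    type_D_contract[OF kerr_h_prod kerr_v_nz]
  by simp

end

section \<open>The invariant \<open>Q\<^sub>1\<close>\<close>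

text \<open>\<open>dF = R F_r (dr/R) + M F_u (du/M)\<close>. The neighbourhood \<open>V\<close> is a
  parameter because \<open>I2\<close> has such a form only where the sign of the sine is
  constant.\<close>

lemma kerr_gradient:
  assumes x: "x \<in> kerr_dom a \<Lambda> m"
    and V: "open V" "x \<in> V" and f: "\<And>y. y \<in> V \<Longrightarrow> f y = F (y $ 2) (cos (y $ 3))"
    and Fr: "((\<lambda>r. F r (cos (x $ 3))) has_real_derivative Fr) (at (x $ 2))"
    and Fu: "((\<lambda>u. F (x $ 2) u) has_real_derivative Fu) (at (cos (x $ 3)))"
  shows "partial c f x = (\<Sum>i\<in>UNIV. quad 0 (Delta_r a \<Lambda> m (x $ 2) * Fr)
    (kerr_M a \<Lambda> (cos (x $ 3)) * Fu) 0 i * kerr_W a \<Lambda> m x $ i $ c)"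
proof -
  have "((\<lambda>\<theta>. F (x $ 2) (cos \<theta>)) has_real_derivative Fu * - sin (x $ 3)) (at (x $ 3))"
    by (rule DERIV_chain2[OF Fu DERIV_cos])
  from has_partial_polar[of "\<lambda>r \<theta>. F r (cos \<theta>)", OF Fr this, of c]
  have "has_partial c f (quad 0 Fr (Fu * - sin (x $ 3)) 0 c) x"
    by (subst has_partial_cong[OF V f]) auto
  then have "partial c f x = quad 0 Fr (Fu * - sin (x $ 3)) 0 c"
    by (rule partial_eqI)
  moreover have "\<forall>c. quad 0 Fr (Fu * - sin (x $ 3)) 0 c = (\<Sum>i\<in>UNIV. quad 0 (Delta_r a \<Lambda> m (x $ 2) * Fr)
    (kerr_M a \<Lambda> (cos (x $ 3)) * Fu) 0 i * kerr_W a \<Lambda> m x $ i $ c)"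
    unfolding forall_4 using kerr_domD[OF x] by (simp add: sum_4 kerr_W_def)
  ultimately show ?thesis by simp
qed

text \<open>\<open>kerr_A + \<i> kerr_B = m / \<zeta>\<^sup>3\<close> for \<open>\<zeta> = r - \<i> a u\<close>, hence both partial derivatives are multiples
  of \<open>(kerr_A + \<i> kerr_B) / \<zeta>\<close>.\<close>

lemma kerr_AB_deriv:
  fixes a m r u :: real
  defines "P \<equiv> r^2 + (a * u)^2"
  defines "A \<equiv> kerr_A a m r u" and "B \<equiv> kerr_B a m r u"
  assumes "P \<noteq> 0"
  shows "((\<lambda>r. kerr_A a m r u) has_real_derivative - 3 * (A * r - B * (a * u)) / P) (at r)"
    and "((\<lambda>r. kerr_B a m r u) has_real_derivative - 3 * (A * (a * u) + B * r) / P) (at r)"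
    and "((\<lambda>u. kerr_A a m r u) has_real_derivative - 3 * a * (A * (a * u) + B * r) / P) (at u)"
    and "((\<lambda>u. kerr_B a m r u) has_real_derivative 3 * a * (A * r - B * (a * u)) / P) (at u)"
proof -
  define Q where "Q = (\<lambda>r u. inverse (r^2 + (a * u)^2))"
  have Q: "((\<lambda>r. Q r u) has_real_derivative - (2 * r * (Q r u * Q r u))) (at r)"
      "((\<lambda>u. Q r u) has_real_derivative - (2 * a^2 * u * (Q r u * Q r u))) (at u)"
    unfolding Q_def using \<open>P \<noteq> 0\<close> unfolding P_def
    by (auto intro!: derivative_eq_intros simp: power2_eq_square)
  have AB: "kerr_A a m r u = m * r * (r^2 - 3 * (a * u)^2) * (Q r u)^3"
    "kerr_B a m r u = m * (a * u) * (3 * r^2 - (a * u)^2) * (Q r u)^3" for r u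
    by (simp_all add: kerr_A_def kerr_B_def Q_def divide_inverse power_inverse)
  define q where "q = Q r u"
  have PQ: "(r * r + a * a * (u * u)) * q = 1"
    using \<open>P \<noteq> 0\<close> unfolding q_def Q_def P_def by (simp add: power2_eq_square mult_ac)
  have div: "y / P = y * q" for y
    by (simp add: q_def Q_def P_def divide_inverse)
  show "((\<lambda>r. kerr_A a m r u) has_real_derivative - 3 * (A * r - B * (a * u)) / P) (at r)"
    unfolding A_def B_def AB div
    by (rule derivative_eq_intros Q refl)+
      (simp add: q_def[symmetric] algebra_simps power2_eq_square power3_eq_cube, use PQ in algebra)
  show "((\<lambda>r. kerr_B a m r u) has_real_derivative - 3 * (A * (a * u) + B * r) / P) (at r)"
    unfolding A_def B_def AB div
    by (rule derivative_eq_intros Q refl)+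
      (simp add: q_def[symmetric] algebra_simps power2_eq_square power3_eq_cube, use PQ in algebra)
  show "((\<lambda>u. kerr_A a m r u) has_real_derivative - 3 * a * (A * (a * u) + B * r) / P) (at u)"
    unfolding A_def B_def AB div
    by (rule derivative_eq_intros Q refl)+
      (simp add: q_def[symmetric] algebra_simps power2_eq_square power3_eq_cube, use PQ in algebra)
  show "((\<lambda>u. kerr_B a m r u) has_real_derivative 3 * a * (A * r - B * (a * u)) / P) (at u)"
    unfolding A_def B_def AB div
    by (rule derivative_eq_intros Q refl)+
      (simp add: q_def[symmetric] algebra_simps power2_eq_square power3_eq_cube, use PQ in algebra)
qed

text \<open>The squared modulus of \<open>m / \<zeta>^3\<close>, where \<open>\<zeta>\<close> has
  squared modulus \<open>P\<close>.\<close>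

lemma kerr_AB_norm:
  assumes "r^2 + (a * u)^2 \<noteq> 0"
  shows "(kerr_A a m r u)^2 + (kerr_B a m r u)^2 = m^2 / (r^2 + (a * u)^2)^3"
proof -
  define P where "P = r^2 + (a * u)^2"
  have "(m * r * (r^2 - 3 * (a * u)^2))^2 + (m * (a * u) * (3 * r^2 - (a * u)^2))^2 = m^2 * P^3"
    unfolding P_def by algebra
  moreover have "P \<noteq> 0" using assms by (simp add: P_def)
  moreover have "(kerr_A a m r u)^2 + (kerr_B a m r u)^2 =
    ((m * r * (r^2 - 3 * (a * u)^2))^2 + (m * (a * u) * (3 * r^2 - (a * u)^2))^2) / (P^3)^2"
    by (simp add: kerr_A_def kerr_B_def P_def power_divide add_divide_distrib)
  moreover have "m^2 * y / y^2 = m^2 / y" for y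
    by (simp add: power2_eq_square)
  ultimately show ?thesis
    unfolding P_def[symmetric] by metis
qed

text \<open>With \<open>z = X + \<i> Y\<close> and \<open>p + \<i> q = 6 z (r + \<i> w) / P\<close> the numerator of \<open>Q1\<close> is a multiple of
  the real part of \<open>(cnj z)\<^sup>2 (p + \<i> q)\<^sup>2\<close>.\<close>

lemma kerr_numerator:
  fixes A B r w P :: real
  defines "X \<equiv> A^2 - B^2" and "Y \<equiv> 2 * A * B"
  defines "p \<equiv> 6 * (X * r - Y * w) / P" and "q \<equiv> 6 * (X * w + Y * r) / P"
  shows "(X^2 - Y^2) * (p^2 - q^2) + 4 * X * Y * (p * q) = 36 * (A^2 + B^2)^4 * (r^2 - w^2) / P^2"
proof -
  have "((X^2 - Y^2) * ((6 * (X * r - Y * w))^2 - (6 * (X * w + Y * r))^2) + 4 * X * Y * (6 * (X * r - Y * w) * (6 * (X * w + Y * r))))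
      = 36 * (X^2 + Y^2)^2 * (r^2 - w^2)"
    by algebra
  moreover have "X^2 + Y^2 = (A^2 + B^2)^2"
    unfolding X_def Y_def by algebra
  ultimately have "((X^2 - Y^2) * ((6 * (X * r - Y * w))^2 - (6 * (X * w + Y * r))^2) + 4 * X * Y * (6 * (X * r - Y * w) * (6 * (X * w + Y * r))))
      = 36 * (A^2 + B^2)^4 * (r^2 - w^2)"
    by (simp flip: power_mult)
  \<comment> \<open>Division by zero yields zero, so the identity also holds for
    \<open>P = 0\<close>.\<close>
  moreover have "c * ((y / P)^2 - (z / P)^2) + d * (y / P * (z / P)) = (c * (y^2 - z^2) + d * (y * z)) / P^2" for c d y z
    by (cases "P = 0") (simp_all add: field_simps power2_eq_square)
  ultimately show ?thesis
    unfolding p_def q_def by simp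
qed

text \<open>The base of the real power is an exact fourth power, which turns the exponent 9/4 into
  the natural exponent 9.\<close>

lemma kerr_powr:
  assumes m: "m > (0::real)" and P: "P > 0"
  shows "1 / (3 * sqrt 3) * ((48^4 * (36 * (m^2 / P^3)^4 * S / P^2) * D / P) / ((48^2 * (m^2 / P^3)^2) powr (9/4)))
    = S * D / (P powr (3/2) * m)"
proof -
  define h where "h = P powr (3/2)"
  define s where "s = sqrt (3::real)"
  have h: "h > 0" using P by (simp add: h_def)
  have hP: "h^2 = P^3"
    using P by (simp add: h_def power2_eq_square powr_numeral flip: powr_add)
  have s: "s > 0" "s^2 = 3" by (simp_all add: s_def)
  \<comment> \<open>\<open>4 * sqrt 3\<close> is the fourth root of \<open>48^2\<close>, and
    \<open>h^4 = P^6\<close>. Positivity of \<open>m\<close> makes \<open>q\<close> positive, so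
    that the powers may be composed.\<close>
  define q where "q = 4 * s * m / h"
  have q: "q > 0" using m h s by (simp add: q_def)
  have "s^4 = (s^2)^2" by (simp flip: power_mult)
  then have s4: "s^4 = 9" by (simp add: s(2))
  have "48^2 * (m^2 / P^3)^2 = q^4"
    unfolding q_def hP[symmetric] by (simp add: power_divide power_mult_distrib s4 flip: power_mult)
  moreover have "(q^4) powr (9/4) = q^9"
    using q by (simp add: powr_powr flip: powr_numeral)
  ultimately have den: "(48^2 * (m^2 / P^3)^2) powr (9/4) = q^9" by simp
  have "s^9 = s^4 * s^4 * s" by (simp add: eval_nat_numeral)
  then have s9: "s^9 = 81 * s" by (simp add: s4)
  show ?thesis
    unfolding den s_def[symmetric] h_def[symmetric]
  proof -
    have P15: "P^12 * P^2 * P = h^10"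
    proof -
      have "P^12 * P^2 * P = (P^3)^5" by (simp flip: power_mult power_add power_Suc2)
      then show ?thesis by (simp add: hP[symmetric] flip: power_mult)
    qed
    have "1 / (3 * s) * (48 ^ 4 * (36 * (m\<^sup>2 / P ^ 3) ^ 4 * S / P\<^sup>2) * D / P / q ^ 9) =
       48^4 * 36 * m^8 * S * D / (3 * s * (P^12 * P^2 * P) * q^9)"
      by (simp add: power_divide flip: power_mult)
    also have "\<dots> = S * D / (h * m)"
      unfolding P15 q_def using h m s
      by (simp add: power_divide power_mult_distrib s9) (simp add: field_simps eval_nat_numeral)
    finally show "1 / (3 * s) * (48 ^ 4 * (36 * (m\<^sup>2 / P ^ 3) ^ 4 * S / P\<^sup>2) * D / P / q ^ 9) = S * D / (h * m)" .
  qed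
qed

lemma kerr_Q1:
  assumes m: "m > 0" and x: "x \<in> kerr_dom a \<Lambda> m" and Xi: "Xi a \<Lambda> \<noteq> 0"
  defines "r \<equiv> x $ 2" and "u \<equiv> cos (x $ 3)"
  defines "P \<equiv> r^2 + (a * u)^2"
  shows "Q1 (kerr_dS_metric a \<Lambda> m) x =
    (r^2 - (a * u)^2) * (Delta_r a \<Lambda> m r - a^2 * kerr_M a \<Lambda> u) / (P powr (3/2) * m)"
proof -
  interpret orthogonal_coframe "kerr_dS_metric a \<Lambda> m" "kerr_dom a \<Lambda> m" "kerr_W a \<Lambda> m" "kerr_E a \<Lambda> m"
    "kerr_h a \<Lambda> m" "kerr_dW a \<Lambda> m" "kerr_ddW a \<Lambda> m" "kerr_om a \<Lambda> m" "kerr_d_om a \<Lambda> m"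
    by (rule kerr_coframe[OF Xi])
  let ?g = "kerr_dS_metric a \<Lambda> m"
  define e where "e = sgn (sin (x $ 3))"
  define A where "A = kerr_A a m r u"
  define B where "B = kerr_B a m r u"
  define R where "R = Delta_r a \<Lambda> m r"
  define M where "M = kerr_M a \<Lambda> u"
  define X where "X = A^2 - B^2"
  define Y where "Y = 2 * A * B"
  \<comment> \<open>\<open>p + \<i> q = 6 z / \<zeta>\<close> is minus the derivative of
    \<open>z = X + \<i> Y = m^2 / \<zeta>^6\<close> by \<open>\<zeta>\<close>. In the
    \<open>u\<close> direction \<open>d\<zeta> = - \<i> a du\<close>, which exchanges
    \<open>p\<close> and \<open>q\<close> up to sign.\<close>
  define p where "p = 6 * (X * r - Y * (a * u)) / P"
  define q where "q = 6 * (X * (a * u) + Y * r) / P"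
  note nz = kerr_domD[OF x]
  have P0: "P \<noteq> 0" "P > 0"
    using nz(2) by (simp_all add: P_def r_def u_def power_mult_distrib order_less_le)
  have R0: "R \<noteq> 0" "M \<noteq> 0"
    using nz by (simp_all add: R_def M_def r_def u_def)
  have e: "e * e = 1"
    using nz by (simp add: e_def sgn_if)
  note AB = kerr_AB_deriv[OF P0(1)[unfolded P_def], of m, folded P_def A_def B_def]
  have I1: "I1 ?g x = 48 * X" and I2: "I2 ?g x = - 48 * e * Y"
    by (simp_all add: kerr_I1[OF x Xi] kerr_I2[OF x Xi] X_def Y_def A_def B_def r_def u_def e_def)
  have k: "k_covector ?g c x = (\<Sum>i\<in>UNIV. quad 0 (48 * R * p) (48 * M * a * q) 0 i * kerr_W a \<Lambda> m x $ i $ c)" for c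
  proof -
    have "partial c (I1 ?g) x = (\<Sum>i\<in>UNIV. quad 0 (Delta_r a \<Lambda> m (x $ 2) * (- 48 * p))
      (kerr_M a \<Lambda> (cos (x $ 3)) * (- 48 * (a * q))) 0 i * kerr_W a \<Lambda> m x $ i $ c)"
    proof (rule kerr_gradient[OF x open_U x, where f = "I1 ?g" and F = "\<lambda>r u. 48 * ((kerr_A a m r u)^2 - (kerr_B a m r u)^2)"])
      show "I1 ?g y = 48 * ((kerr_A a m (y $ 2) (cos (y $ 3)))^2 - (kerr_B a m (y $ 2) (cos (y $ 3)))^2)"
        if "y \<in> kerr_dom a \<Lambda> m" for y
        by (rule kerr_I1[OF that Xi])
      show "((\<lambda>r. 48 * ((kerr_A a m r (cos (x $ 3)))^2 - (kerr_B a m r (cos (x $ 3)))^2)) has_real_derivative - 48 * p) (at (x $ 2))"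
        unfolding r_def[symmetric] u_def[symmetric]
        by (rule derivative_eq_intros AB refl)+
          (use P0 in \<open>simp add: A_def[symmetric] B_def[symmetric] p_def X_def Y_def field_simps power2_eq_square\<close>)
      show "((\<lambda>u. 48 * ((kerr_A a m (x $ 2) u)^2 - (kerr_B a m (x $ 2) u)^2)) has_real_derivative - 48 * (a * q)) (at (cos (x $ 3)))"
        unfolding r_def[symmetric] u_def[symmetric]
        by (rule derivative_eq_intros AB refl)+
          (use P0 in \<open>simp add: A_def[symmetric] B_def[symmetric] q_def X_def Y_def field_simps power2_eq_square\<close>)
    qed
    then show ?thesis
      by (simp add: k_covector_def sum_4 R_def M_def r_def u_def algebra_simps)
  qed
  have l: "l_covector ?g c x = (\<Sum>i\<in>UNIV. quad 0 (- 48 * e * R * q) (48 * e * M * a * p) 0 i * kerr_W a \<Lambda> m x $ i $ c)" for c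
  proof -
    \<comment> \<open>On this neighbourhood the sine keeps its sign, so \<open>e\<close> can be
      treated as a constant when \<open>I2\<close> is differentiated.\<close>
    let ?V = "kerr_dom a \<Lambda> m \<inter> {y. 0 < sin (y $ 3) * sin (x $ 3)}"
    have V: "open ?V"
      by (intro open_Int open_U open_Collect_less continuous_intros)
    have xV: "x \<in> ?V"
      using x nz by (auto simp: zero_less_mult_iff)
    have I2': "I2 ?g y = - 96 * e * (kerr_A a m (y $ 2) (cos (y $ 3)) * kerr_B a m (y $ 2) (cos (y $ 3)))" if "y \<in> ?V" for y
    proof -
      have "sgn (sin (y $ 3)) = e"
        using that by (auto simp: e_def zero_less_mult_iff)
      then show ?thesis
        using that kerr_I2[of y a \<Lambda> m] Xi by simp
    qed
    have "partial c (I2 ?g) x = (\<Sum>i\<in>UNIV. quad 0 (Delta_r a \<Lambda> m (x $ 2) * (48 * e * q))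
      (kerr_M a \<Lambda> (cos (x $ 3)) * (- 48 * e * (a * p))) 0 i * kerr_W a \<Lambda> m x $ i $ c)"
    proof (rule kerr_gradient[OF x V xV, where f = "I2 ?g" and F = "\<lambda>r u. - 96 * e * (kerr_A a m r u * kerr_B a m r u)"])
      show "I2 ?g y = - 96 * e * (kerr_A a m (y $ 2) (cos (y $ 3)) * kerr_B a m (y $ 2) (cos (y $ 3)))"
        if "y \<in> ?V" for y
        by (rule I2'[OF that])
      show "((\<lambda>r. - 96 * e * (kerr_A a m r (cos (x $ 3)) * kerr_B a m r (cos (x $ 3)))) has_real_derivative 48 * e * q) (at (x $ 2))"
        unfolding r_def[symmetric] u_def[symmetric]
        by (rule derivative_eq_intros AB refl)+
          (use P0 in \<open>simp add: A_def[symmetric] B_def[symmetric] q_def X_def Y_def field_simps power2_eq_square\<close>)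
      show "((\<lambda>u. - 96 * e * (kerr_A a m (x $ 2) u * kerr_B a m (x $ 2) u)) has_real_derivative - 48 * e * (a * p)) (at (cos (x $ 3)))"
        unfolding r_def[symmetric] u_def[symmetric]
        by (rule derivative_eq_intros AB refl)+
          (use P0 in \<open>simp add: A_def[symmetric] B_def[symmetric] p_def X_def Y_def field_simps power2_eq_square\<close>)
    qed
    then show ?thesis
      by (simp add: l_covector_def sum_4 R_def M_def r_def u_def algebra_simps)
  qed
  have h: "kerr_h a \<Lambda> m x 2 = P * R" "kerr_h a \<Lambda> m x 3 = P * M"
    by (simp_all add: kerr_h_def carter_h_def rho2_def P_def R_def M_def r_def u_def power_mult_distrib)
  have I5: "I5 ?g x = 48^2 * (R * p^2 + M * a^2 * q^2) / P"
    unfolding I5_def contract1_frame[where u = "k_covector _" and v = "k_covector _", OF x k k] using P0 R0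
    by (simp add: sum_4 h) (simp add: field_simps power2_eq_square)
  have I6: "I6 ?g x = 48^2 * (e * e) * (R * q^2 + M * a^2 * p^2) / P"
    unfolding I6_def contract1_frame[where u = "l_covector _" and v = "l_covector _", OF x l l] using P0 R0
    by (simp add: sum_4 h) (simp add: field_simps power2_eq_square)
  have I7: "I7 ?g x = - (48^2 * e * (R - M * a^2) * (p * q)) / P"
    unfolding I7_def contract1_frame[where u = "k_covector _" and v = "l_covector _", OF x k l] using P0 R0
    by (simp add: sum_4 h) (simp add: field_simps power2_eq_square)
  \<comment> \<open>As \<open>p\<close> and \<open>q\<close> trade places between the
    \<open>r\<close> and \<open>u\<close> directions, \<open>M\<close> enters \<open>I5 - I6\<close>
    and \<open>I7\<close> with the opposite sign to \<open>R\<close>; this gives the common factor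
    \<open>R - a^2 * M\<close>. The orientation \<open>e\<close> occurs only squared.\<close>
  have num: "((I1 ?g x)\<^sup>2 - (I2 ?g x)\<^sup>2) * (I5 ?g x - I6 ?g x) + 4 * I1 ?g x * I2 ?g x * I7 ?g x =
      48^4 * ((X^2 - Y^2) * (p^2 - q^2) + 4 * X * Y * (p * q)) * (R - a^2 * M) / P"
  proof -
    have "((I1 ?g x)\<^sup>2 - (I2 ?g x)\<^sup>2) * (I5 ?g x - I6 ?g x) + 4 * I1 ?g x * I2 ?g x * I7 ?g x =
      ((48 * X)^2 - 48^2 * (e * e) * Y^2) * (48^2 * (R * p^2 + M * a^2 * q^2) / P - 48^2 * (e * e) * (R * q^2 + M * a^2 * p^2) / P)
       + 4 * (48 * X) * (e * e) * (48 * Y) * (48^2 * (R - M * a^2) * (p * q) / P)"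
      unfolding I1 I2 I5 I6 I7 by (simp add: power2_eq_square mult_ac)
    also have "\<dots> = 48^4 * ((X^2 - Y^2) * (p^2 - q^2) + 4 * X * Y * (p * q)) * (R - a^2 * M) / P"
      unfolding e divide_inverse by algebra
    finally show ?thesis .
  qed
  have AB2: "A^2 + B^2 = m^2 / P^3"
    using kerr_AB_norm[of r a u m] P0 by (simp add: A_def B_def P_def)
  have den: "(I1 ?g x)\<^sup>2 + (I2 ?g x)\<^sup>2 = 48^2 * (m^2 / P^3)^2"
  proof -
    have "(I1 ?g x)\<^sup>2 + (I2 ?g x)\<^sup>2 = 48^2 * (X^2 + (e * e) * Y^2)"
      unfolding I1 I2 by (simp add: power2_eq_square algebra_simps)
    also have "\<dots> = 48^2 * (A^2 + B^2)^2"
      unfolding e X_def Y_def by (simp add: power2_eq_square algebra_simps)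
    finally show ?thesis unfolding AB2 .
  qed
  have "Q1 ?g x = 1 / (3 * sqrt 3) *
      ((48^4 * (36 * (m^2 / P^3)^4 * (r^2 - (a * u)^2) / P^2) * (R - a^2 * M) / P) / ((48^2 * (m^2 / P^3)^2) powr (9/4)))"
    unfolding Q1_def num den
    unfolding p_def q_def X_def Y_def kerr_numerator AB2 ..
  then show ?thesis
    unfolding kerr_powr[OF m P0(2)] by (simp add: R_def M_def)
qed

theorem theorem29:
  fixes a \<Lambda> m t r \<theta> \<phi> :: real
  assumes "m > 0"
    and "rho2 a r \<theta> \<noteq> 0"
    and "Delta_r a \<Lambda> m r \<noteq> 0"
    and "Delta_theta a \<Lambda> \<theta> > 0"
    and "Xi a \<Lambda> \<noteq> 0"
    and "sin \<theta> \<noteq> 0"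
  shows "Q1 (kerr_dS_metric a \<Lambda> m) (vector [t, r, \<theta>, \<phi>]) =
    - ((\<Lambda> * a^4 * (cos \<theta>)^4 - \<Lambda> * a^4 * (cos \<theta>)\<^sup>2 - \<Lambda> * a\<^sup>2 * r\<^sup>2 - \<Lambda> * r^4
         + 3 * a\<^sup>2 * (cos \<theta>)\<^sup>2 - 6 * m * r + 3 * r\<^sup>2) * (a\<^sup>2 * (cos \<theta>)\<^sup>2 - r\<^sup>2))
      / (3 * (r\<^sup>2 + a\<^sup>2 * (cos \<theta>)\<^sup>2) powr (3/2) * m)"
proof -
  define u where "u = cos \<theta>"
  let ?x = "vector [t, r, \<theta>, \<phi>] :: real^4"
  have "?x \<in> kerr_dom a \<Lambda> m"
    using assms by (simp add: kerr_dom_def vector_4)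
  from kerr_Q1[OF assms(1) this assms(5)]
  have Q: "Q1 (kerr_dS_metric a \<Lambda> m) ?x = (r^2 - a^2 * u^2) * (Delta_r a \<Lambda> m r - a^2 * kerr_M a \<Lambda> u) /
      ((r^2 + a^2 * u^2) powr (3/2) * m)"
    by (simp add: vector_4 u_def power_mult_distrib)
  \<comment> \<open>The long polynomial of the claim is \<open>3 * D\<close>; its second factor is
    \<open>r^2 - a^2 * u^2\<close> negated, which accounts for the leading minus sign.\<close>
  define D where "D = Delta_r a \<Lambda> m r - a^2 * kerr_M a \<Lambda> u"
  have D: "\<Lambda> * a^4 * u^4 - \<Lambda> * a^4 * u\<^sup>2 - \<Lambda> * a\<^sup>2 * r\<^sup>2 - \<Lambda> * r^4
         + 3 * a\<^sup>2 * u\<^sup>2 - 6 * m * r + 3 * r\<^sup>2 = 3 * D"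
    unfolding D_def Delta_r_def kerr_M_def by (simp add: field_simps power2_eq_square power4_eq_xxxx)
  have "S * D / (H * m) = - (3 * D * (- S)) / (3 * H * m)" for S H
    by simp
  from this[of "r^2 - a^2 * u^2"] show ?thesis
    unfolding Q u_def[symmetric] D D_def[symmetric] by simp
qed

end
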